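(* Let $X$ be a nonzero $n\times m$ complex matrix, let $$H=\begin{bmatrix}0 & X\\ X^* & 0\end{bmatrix},$$ let $B$ be the non-backtracking operator associated with $H$, and let $\gamma\in(0,1]$ be a constant such that $$\|X\|_{2,\infty}\wedge\|X^*\|_{2,\infty}\le\gamma^{1/2}\|H\|_{2,\infty}.$$ Then $$\sigma_{\max}^2(X)\le\|H\|_{2,\infty}^2\,f\Big(\frac{\rho(B)}{\|H\|_{2,\infty}}\Big)+12\gamma^{-5/4}\,g\Big(\frac{\rho(B)}{\|H\|_{2,\infty}}\Big)\|H\|_{2,\infty}\|H\|_{1,\infty}+36\gamma^{-2}\|H\|_{1,\infty}^2,$$ where $$f(x)=\begin{cases}(x+x^{-1})\big(x+\frac{\gamma}{x}\big),&x\ge\gamma^{1/4},\\ (\gamma^{1/2}+1)^2,&0\le x<\gamma^{1/4},\end{cases}\qquad g(x)=\begin{cases}2\big(x+\frac1x\big),&x\ge\gamma^{1/4},\\ 4,&0\le x<\gamma^{1/4}.\end{cases}$$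
   Context: For a matrix $H$: $\|H\|_{1,\infty}:=\max_{ij}|H_{ij}|$ and $\|H\|_{2,\infty}:=\max_i\big(\sum_j|H_{ij}|^2\big)^{1/2}$ (similarly for $X$ and $X^*$). Non-backtracking operator: for $H\in M_k(\mathbb C)$, it is the $k^2\times k^2$ matrix $B$ indexed by ordered pairs, with $B_{ef}:=H_{uv}\mathbf 1_{j=u}\mathbf 1_{i\ne v}$ for $e=(i,j)$, $f=(u,v)$, $i,j,u,v\in[k]$; here $k=n+m$. $\rho(B)$ is the spectral radius of $B$, $\sigma_{\max}(X)$ the largest singular value of $X$, and $\wedge$ denotes the minimum. *)

theory Defs
  imports
    "Jordan_Normal_Form.Spectral_Radius"
    "Jordan_Normal_Form.Schur_Decomposition"
begin

definition norm_1_inf :: "complex mat \<Rightarrow> real" where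
  "norm_1_inf A = Max {cmod (A $$ (i, j)) | i j. i < dim_row A \<and> j < dim_col A}"

definition norm_2_inf :: "complex mat \<Rightarrow> real" where
  "norm_2_inf A = Max {sqrt (\<Sum>j<dim_col A. (cmod (A $$ (i, j)))\<^sup>2) | i. i < dim_row A}"

text \<open>The singular values are the nonnegative square roots of the eigenvalues of
  $A^* A$.  If $A$ has more columns than rows this adds the value $0$ to the usual
  list of $\min(n,m)$ singular values, which does not affect the largest one.\<close>

definition singular_values :: "complex mat \<Rightarrow> real set" where
  "singular_values A =
     {s. 0 \<le> s \<and> eigenvalue (mat_adjoint A * A) (complex_of_real (s\<^sup>2))}"

definition sigma_max :: "complex mat \<Rightarrow> real" where
  "sigma_max A = Max (singular_values A)"

definition hermitization :: "complex mat \<Rightarrow> complex mat" where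
  "hermitization X =
     four_block_mat (0\<^sub>m (dim_row X) (dim_row X)) X
                    (mat_adjoint X) (0\<^sub>m (dim_col X) (dim_col X))"

text \<open>For a square matrix $H$ of size $k$, the ordered pair $(i,j)$ with $i,j < k$ is
  encoded as the index $i k + j < k^2$, so that a row or column index $e$ stands for the
  pair \<open>(e div k, e mod k)\<close>; see the lemma below.  The spectral radius does not depend
  on this enumeration of the pairs.\<close>

definition nonbacktracking :: "complex mat \<Rightarrow> complex mat" where
  "nonbacktracking H =
     (let k = dim_row H in
      mat (k\<^sup>2) (k\<^sup>2) (\<lambda>(e, e').
        let i = e div k; j = e mod k; u = e' div k; v = e' mod k
        in if j = u \<and> i \<noteq> v then H $$ (u, v) else 0))"

lemma nonbacktracking_index:
  assumes "H \<in> carrier_mat k k" "i < k" "j < k" "u < k" "v < k"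
  shows "nonbacktracking H $$ (i * k + j, u * k + v) =
           (if j = u \<and> i \<noteq> v then H $$ (u, v) else 0)"
proof -
  have bound: "a * k + b < k\<^sup>2" if "a < k" "b < k" for a b
  proof -
    have "a * k + b < Suc a * k" using that by simp
    also have "\<dots> \<le> k * k" using that by (intro mult_le_mono1) simp
    finally show ?thesis by (simp add: power2_eq_square)
  qed
  show ?thesis
    using assms by (simp add: nonbacktracking_def Let_def bound)
qed

definition f_bound :: "real \<Rightarrow> real \<Rightarrow> real" where
  "f_bound \<gamma> x =
     (if x \<ge> \<gamma> powr (1/4) then (x + 1 / x) * (x + \<gamma> / x)
      else (\<gamma> powr (1/2) + 1)\<^sup>2)"

definition g_bound :: "real \<Rightarrow> real \<Rightarrow> real" where
  "g_bound \<gamma> x = (if x \<ge> \<gamma> powr (1/4) then 2 * (x + 1 / x) else 4)"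

end

theory Submission
  imports Defs "HOL-Analysis.Topology_Euclidean_Space" "HOL-Analysis.Convex"
begin

text \<open>
  Write $h = \|H\|_{1,\infty}$, $N = \|H\|_{2,\infty}$, $r = \|X\|_{2,\infty}$ and
  $c = \|X^*\|_{2,\infty}$.  For real $t > h$ let $H(t)$ have the entries
  $t H_{ij} / (t^2 - |H_{ij}|^2)$ and let $M(t)$ be the diagonal matrix with entries
  $1 + \sum_l |H_{il}|^2 / (t^2 - |H_{il}|^2)$.  By the Ihara--Bass correspondence, a null vector of
  $M(t) - H(t)$ produces an eigenvector of $B$ with eigenvalue $t$
  (\<open>bethe_hessian_kernel_eigenvalue\<close>).  So this Hermitian matrix is invertible for every
  $t > \max(\rho(B), h)$.  It is positive definite for large $t$, and a continuous path of
  Hermitian matrices cannot leave the positive definite cone without becoming singular; so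
  $M(t) - H(t)$ is positive definite for all $t > \max(\rho(B), h)$ (\<open>bethe_hessian_pos_def\<close>).

  For the Hermitization of $X$, positivity bounds the off-diagonal block $X(t)$ by the
  geometric mean of the largest diagonal entries of the two blocks of $M(t)$.  These are at most
  $1 + r^2 / (t^2 - h^2)$ and $1 + c^2 / (t^2 - h^2)$ (\<open>weighted_form_le\<close>).
  As $X - t X(t)$ is cubic in the entries of $X$, the Schur test shows that it has norm at
  most $h r c / (t^2 - h^2)$ (\<open>bilinear_form_le\<close>).  Evaluating at a top singular pair,
  \[ \sigma_{\max}(X) \le t \sqrt{(1 + r^2 / (t^2 - h^2)) (1 + c^2 / (t^2 - h^2))}
       + h r c / (t^2 - h^2) . \]

  Both $r$ and $c$ are at most $N$, and one of them is at most $\gamma^{1/2} N$.  Now take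
  $t^2 = (N y)^2 + h^2$ with $y = \max(\rho(B) / N, \gamma^{1/4})$.  The square of the leading
  term at $h = 0$ is then at most $N^2 (y + 1/y)(y + \gamma/y) = N^2 f(\rho(B) / N)$, and everything
  else carries a factor $h$ or $h^2$ with a coefficient that is easily within the allowance of the statement
  (\<open>deviation_scalar_bound\<close>, \<open>truncated_bound_le\<close>).
\<close>

unbundle no vec_syntax
hide_const (open) Finite_Cartesian_Product.vec

section \<open>Hermitian forms and continuation of positive definiteness\<close>

text \<open>The form is only ever used for Hermitian matrices, where the double sum is real
  already.  Matrices and vectors are functions on indices below $k$, so that block structure and
  limits can be handled entrywise.\<close>

definition qform :: "nat \<Rightarrow> (nat \<Rightarrow> nat \<Rightarrow> complex) \<Rightarrow> (nat \<Rightarrow> complex) \<Rightarrow> real" where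
  "qform k A v = Re (\<Sum>i<k. \<Sum>j<k. cnj (v i) * A i j * v j)"

definition norm_sq :: "nat \<Rightarrow> (nat \<Rightarrow> complex) \<Rightarrow> real" where
  "norm_sq k v = (\<Sum>i<k. (cmod (v i))\<^sup>2)"

lemma norm_sq_nonneg: "0 \<le> norm_sq k v"
  by (simp add: norm_sq_def sum_nonneg)

lemma norm_sq_eq_0_iff: "norm_sq k v = 0 \<longleftrightarrow> (\<forall>i<k. v i = 0)"
  by (auto simp: norm_sq_def sum_nonneg_eq_0_iff)

lemma norm_sq_scale: "norm_sq k (\<lambda>i. complex_of_real c * v i) = c\<^sup>2 * norm_sq k v"
  by (simp add: norm_sq_def norm_mult power_mult_distrib sum_distrib_left)

lemma qform_scale: "qform k A (\<lambda>i. complex_of_real c * v i) = c\<^sup>2 * qform k A v"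
proof -
  have "(\<Sum>i<k. \<Sum>j<k. cnj (of_real c * v i) * A i j * (of_real c * v j))
      = of_real (c\<^sup>2) * (\<Sum>i<k. \<Sum>j<k. cnj (v i) * A i j * v j)"
    by (simp add: sum_distrib_left power2_eq_square mult_ac)
  then show ?thesis unfolding qform_def by (simp only: times_complex.sel Re_complex_of_real Im_complex_of_real)
qed

lemma qform_add_scaled:
  assumes herm: "\<And>i j. i < k \<Longrightarrow> j < k \<Longrightarrow> A j i = cnj (A i j)"
  shows "qform k A (\<lambda>i. v i + complex_of_real e * w i)
       = qform k A v + 2 * e * Re (\<Sum>i<k. cnj (w i) * (\<Sum>j<k. A i j * v j)) + e\<^sup>2 * qform k A w"
proof -
  let ?f = "\<lambda>v w. (\<Sum>i<k. \<Sum>j<k. cnj (v i) * A i j * w j)"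
  have sym: "?f v w = cnj (?f w v)"
  proof -
    have "?f v w = (\<Sum>j<k. \<Sum>i<k. cnj (v i) * A i j * w j)" by (rule sum.swap)
    also have "\<dots> = cnj (?f w v)"
      unfolding cnj_sum
    proof (intro sum.cong refl)
      fix i j assume "i \<in> {..<k}" "j \<in> {..<k}"
      then show "cnj (v j) * A j i * w i = cnj (cnj (w i) * A i j * v j)"
        using herm[of i j] by simp
    qed
    finally show ?thesis .
  qed
  have "?f (\<lambda>i. v i + complex_of_real e * w i) (\<lambda>i. v i + complex_of_real e * w i)
     = ?f v v + of_real e * (?f w v + ?f v w) + of_real (e\<^sup>2) * ?f w w"
    by (simp add: sum_distrib_left sum.distrib algebra_simps power2_eq_square)
  moreover have "Re (?f w v + ?f v w) = 2 * Re (?f w v)"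
    using arg_cong[OF sym, of Re] by (simp only: plus_complex.sel cnj.sel)
  moreover have "?f w v = (\<Sum>i<k. cnj (w i) * (\<Sum>j<k. A i j * v j))"
    by (simp add: sum_distrib_left mult.assoc)
  ultimately show ?thesis unfolding qform_def
    by (simp only: plus_complex.sel times_complex.sel Re_complex_of_real Im_complex_of_real)
qed

text \<open>If $Av \neq 0$, then moving from $v$ a little in the direction $-Av$ would decrease the
  form to first order, below its minimum $0$.\<close>

lemma psd_null_vector:
  assumes herm: "\<And>i j. i < k \<Longrightarrow> j < k \<Longrightarrow> A j i = cnj (A i j)"
    and psd: "\<And>w. 0 \<le> qform k A w"
    and null: "qform k A v = 0"
    and "i < k"
  shows "(\<Sum>j<k. A i j * v j) = 0"
proof -
  define y where "y i = (\<Sum>j<k. A i j * v j)" for i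
  have y2: "(\<Sum>i<k. cnj (- y i) * (\<Sum>j<k. A i j * v j)) = - of_real (norm_sq k y)"
    unfolding y_def[symmetric] norm_sq_def
    by (simp add: sum_negf complex_norm_square mult.commute del: of_real_power)
  have key: "2 * e * norm_sq k y \<le> e\<^sup>2 * qform k A (\<lambda>i. - y i)" for e
  proof -
    have "0 \<le> qform k A (\<lambda>i. v i + complex_of_real e * - y i)" by (rule psd)
    also have "\<dots> = qform k A v + 2 * e * Re (\<Sum>i<k. cnj (- y i) * (\<Sum>j<k. A i j * v j))
        + e\<^sup>2 * qform k A (\<lambda>i. - y i)"
      by (rule qform_add_scaled[OF herm])
    finally show ?thesis unfolding y2 null by simp
  qed
  have "norm_sq k y \<le> 0"
  proof (rule ccontr)
    assume "\<not> norm_sq k y \<le> 0"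
    then have pos: "0 < norm_sq k y" by simp
    define q where "q = qform k A (\<lambda>i. - y i)"
    have q: "0 \<le> q" unfolding q_def by (rule psd)
    \<comment> \<open>With this step size the quadratic term is at most half of the first-order decrease.\<close>
    define e where "e = norm_sq k y / (1 + q)"
    have e: "0 < e" using pos q by (simp add: e_def)
    have "2 * norm_sq k y \<le> e * q"
      using key[of e] e by (simp add: power2_eq_square q_def)
    also have "\<dots> \<le> norm_sq k y" using q pos by (simp add: e_def field_simps)
    finally show False using pos by simp
  qed
  then have "norm_sq k y = 0" using norm_sq_nonneg[of k y] by simp
  then show ?thesis using \<open>i < k\<close> by (simp add: norm_sq_eq_0_iff y_def)
qed

lemma unit_sphere_seq_compact:
  fixes v :: "nat \<Rightarrow> nat \<Rightarrow> complex"
  assumes unit: "\<And>n. norm_sq k (v n) = 1"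
  obtains r u where "strict_mono (r :: nat \<Rightarrow> nat)" "\<And>i. i < k \<Longrightarrow> (\<lambda>n. v (r n) i) \<longlonglongrightarrow> u i"
proof -
  have bnd: "cmod (v n i) \<le> 1" if "i < k" for n i
  proof -
    have "(cmod (v n i))\<^sup>2 \<le> norm_sq k (v n)"
      unfolding norm_sq_def using that by (intro member_le_sum) auto
    then show ?thesis unfolding unit by (simp add: abs_square_le_1)
  qed
  have "\<forall>\<delta>\<subseteq>{..<k}. \<exists>l. \<exists>r::nat\<Rightarrow>nat. strict_mono r \<and>
      (\<forall>\<epsilon>>0. eventually (\<lambda>n. \<forall>i\<in>\<delta>. dist (v (r n) i) (l i) < \<epsilon>) sequentially)"
    by (rule compact_lemma_general[where unproj = id])
       (auto simp: bounded_iff intro!: exI[of _ 1] bnd)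
  then obtain u r where r: "strict_mono r"
    and lim: "\<And>\<epsilon>. \<epsilon> > 0 \<Longrightarrow> eventually (\<lambda>n. \<forall>i\<in>{..<k}. dist (v (r n) i) (u i) < \<epsilon>) sequentially"
    by blast
  have "(\<lambda>n. v (r n) i) \<longlonglongrightarrow> u i" if "i < k" for i
    unfolding tendsto_iff
    using that by (auto intro: eventually_mono[OF lim])
  then show ?thesis using r that by blast
qed

text \<open>Along a continuous path of Hermitian matrices, positive definiteness can only be lost at a
  singular matrix.  The proof looks at the last parameter $s$ at which the form takes a
  non-positive value on the unit sphere: by compactness the value is attained, and as the form is
  positive beyond $s$, it is positive semidefinite at $s$ itself.  The vector that attains the value is
  then a null vector.\<close>

lemma pos_def_continuation:
  fixes A :: "real \<Rightarrow> nat \<Rightarrow> nat \<Rightarrow> complex"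
  assumes "a \<le> b"
    and herm: "\<And>t i j. t \<in> {a..b} \<Longrightarrow> i < k \<Longrightarrow> j < k \<Longrightarrow> A t j i = cnj (A t i j)"
    and cont: "\<And>i j. i < k \<Longrightarrow> j < k \<Longrightarrow> continuous_on {a..b} (\<lambda>t. A t i j)"
    and inj: "\<And>t v. t \<in> {a..b} \<Longrightarrow> (\<And>i. i < k \<Longrightarrow> (\<Sum>j<k. A t i j * v j) = 0) \<Longrightarrow> norm_sq k v = 0"
    and pos: "\<And>v. 0 < norm_sq k v \<Longrightarrow> 0 < qform k (A b) v"
    and v: "0 < norm_sq k v"
  shows "0 < qform k (A a) v"
proof (rule ccontr)
  assume neg: "\<not> 0 < qform k (A a) v"
  define T where "T = {t \<in> {a..b}. \<exists>v. norm_sq k v = 1 \<and> qform k (A t) v \<le> 0}"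
  have T_I: "t \<in> T" if "t \<in> {a..b}" "norm_sq k v > 0" "qform k (A t) v \<le> 0" for t v
  proof -
    define c where "c = 1 / sqrt (norm_sq k v)"
    have c: "c\<^sup>2 * norm_sq k v = 1" using that by (simp add: c_def power_divide)
    have "norm_sq k (\<lambda>i. of_real c * v i) = 1"
      unfolding norm_sq_scale by (rule c)
    moreover have "qform k (A t) (\<lambda>i. of_real c * v i) \<le> 0"
      unfolding qform_scale using that by (simp add: mult_nonneg_nonpos)
    ultimately show ?thesis using that unfolding T_def by blast
  qed
  define s where "s = Sup T"
  have aT: "a \<in> T" using T_I[of a v] neg v \<open>a \<le> b\<close> by simp
  have bdd: "bdd_above T" by (rule bdd_aboveI[of _ b]) (simp add: T_def)
  have sab: "s \<in> {a..b}"
    unfolding s_def using aT cSup_upper[OF aT bdd] by (auto simp: T_def intro!: cSup_least)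
  obtain t where tT: "\<And>n. t n \<in> T" and tlim: "t \<longlonglongrightarrow> s"
    using closure_contains_Sup[OF _ bdd] aT unfolding closure_sequential s_def by blast
  have "\<exists>w. \<forall>n. norm_sq k (w n) = 1 \<and> qform k (A (t n)) (w n) \<le> 0"
    using tT unfolding T_def by (intro choice) auto
  then obtain w where w1: "\<And>n. norm_sq k (w n) = 1" and wq: "\<And>n. qform k (A (t n)) (w n) \<le> 0"
    by blast
  obtain r u where r: "strict_mono (r :: nat \<Rightarrow> nat)"
    and wlim: "\<And>i. i < k \<Longrightarrow> (\<lambda>n. w (r n) i) \<longlonglongrightarrow> u i"
    by (rule unit_sphere_seq_compact[where v = w and k = k, OF w1]) blast
  have tend: "(\<lambda>n. A (p n) i j) \<longlonglongrightarrow> A s i j"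
    if "\<And>n. p n \<in> {a..b}" "p \<longlonglongrightarrow> s" "i < k" "j < k" for p i j
    using continuous_on_tendsto_compose[OF cont[OF that(3,4)] that(2) sab] that(1) by simp
  have u1: "norm_sq k u = 1"
  proof -
    have "(\<lambda>n. norm_sq k (w (r n))) \<longlonglongrightarrow> norm_sq k u"
      unfolding norm_sq_def by (intro tendsto_intros wlim) auto
    then show ?thesis unfolding w1 by (simp add: LIMSEQ_const_iff)
  qed
  have uq: "qform k (A s) u \<le> 0"
  proof -
    have "(\<lambda>n. t (r n)) \<longlonglongrightarrow> s" using LIMSEQ_subseq_LIMSEQ[OF tlim r] by (simp add: o_def)
    moreover have "\<And>n. t (r n) \<in> {a..b}" using tT by (simp add: T_def)
    ultimately have "(\<lambda>n. qform k (A (t (r n))) (w (r n))) \<longlonglongrightarrow> qform k (A s) u"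
      unfolding qform_def by (intro tendsto_intros wlim tend) auto
    then show ?thesis by (rule LIMSEQ_le_const2) (use wq in auto)
  qed
  have "s \<noteq> b" using pos[of u] u1 uq by auto
  then have sb: "s < b" using sab by simp
  have psd: "0 \<le> qform k (A s) x" for x
  proof (cases "norm_sq k x = 0")
    case True
    then show ?thesis by (simp add: norm_sq_eq_0_iff qform_def)
  next
    case False
    then have x: "0 < norm_sq k x" using norm_sq_nonneg[of k x] by simp
    define p where "p n = s + (b - s) / real (Suc n)" for n
    have p: "p n \<in> {a..b}" "s < p n" for n
    proof -
      have "(b - s) / real (Suc n) \<le> (b - s) / 1" using sb by (intro divide_left_mono) auto
      moreover show "s < p n" using sb by (simp add: p_def)
      ultimately show "p n \<in> {a..b}" using sab unfolding p_def by auto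
    qed
    have "p \<longlonglongrightarrow> s + 0" unfolding p_def
      by (intro tendsto_add tendsto_const lim_const_over_n[THEN LIMSEQ_Suc])
    then have "(\<lambda>n. qform k (A (p n)) x) \<longlonglongrightarrow> qform k (A s) x"
      unfolding qform_def by (intro tendsto_intros tend p) auto
    moreover have "0 \<le> qform k (A (p n)) x" for n
    proof (rule ccontr)
      assume "\<not> 0 \<le> qform k (A (p n)) x"
      then have "p n \<in> T" by (intro T_I[OF p(1) x]) simp
      then have "p n \<le> s" unfolding s_def by (rule cSup_upper[OF _ bdd])
      then show False using p(2)[of n] by simp
    qed
    ultimately show ?thesis by (intro LIMSEQ_le_const) auto
  qed
  have "norm_sq k u = 0"
  proof (rule inj[OF sab])
    fix i assume "i < k"
    moreover have "qform k (A s) u = 0" using uq psd[of u] by simp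
    ultimately show "(\<Sum>j<k. A s i j * u j) = 0"
      by (intro psd_null_vector[OF herm[OF sab] psd])
  qed
  then show False using u1 by simp
qed

section \<open>The Ihara--Bass correspondence\<close>

text \<open>This is the matrix $M(t) - H(t)$ of the Ihara--Bass formula for weighted graphs, where
  $H(t)_{ij} = t H_{ij} / (t^2 - |H_{ij}|^2)$ and $M(t)$ is diagonal with entries
  $1 + \sum_l |H_{il}|^2 / (t^2 - |H_{il}|^2)$.\<close>

definition bethe_hessian :: "nat \<Rightarrow> (nat \<Rightarrow> nat \<Rightarrow> complex) \<Rightarrow> real \<Rightarrow> nat \<Rightarrow> nat \<Rightarrow> complex" where
  "bethe_hessian k H t i j =
     (if i = j then of_real (1 + (\<Sum>l<k. (cmod (H i l))\<^sup>2 / (t\<^sup>2 - (cmod (H i l))\<^sup>2))) else 0)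
     - of_real t * H i j / of_real (t\<^sup>2 - (cmod (H i j))\<^sup>2)"

lemma sum_lessThan_mult:
  "(\<Sum>e<k * l. f e) = (\<Sum>u<k. \<Sum>v<l. f (u * l + v))" for f :: "nat \<Rightarrow> 'a::comm_monoid_add"
proof -
  have "(\<Sum>e<k * l. f e) = (\<Sum>u<k. sum f {u * l..<u * l + l})"
    by (rule sum.nat_group[symmetric])
  moreover have "sum f {u * l..<u * l + l} = (\<Sum>v<l. f (u * l + v))" for u
    using sum.shift_bounds_nat_ivl[of f 0 "u * l" l] by (simp add: add.commute lessThan_atLeast0)
  ultimately show ?thesis by simp
qed

lemma nonbacktracking_carrier:
  "H \<in> carrier_mat k k \<Longrightarrow> nonbacktracking H \<in> carrier_mat (k\<^sup>2) (k\<^sup>2)"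
  by (simp add: nonbacktracking_def Let_def)

text \<open>The sum over $k^2$ indices is a double sum over pairs, of which only those starting at $j$
  survive; the excluded backtracking pair $(j, i)$ is written as a correction to the full sum.\<close>

lemma nonbacktracking_mult_pairs:
  assumes M: "M \<in> carrier_mat k k" and ij: "i < k" "j < k"
  shows "(nonbacktracking M *\<^sub>v vec (k\<^sup>2) (\<lambda>e. W (e div k) (e mod k))) $ (i * k + j)
       = (\<Sum>v<k. M $$ (j, v) * W j v) - M $$ (j, i) * W j i"
proof -
  have bound: "a * k + b < k\<^sup>2" if "a < k" "b < k" for a b
  proof -
    have "a * k + b < Suc a * k" using that by simp
    also have "\<dots> \<le> k * k" using that by (intro mult_le_mono1) simp
    finally show ?thesis by (simp add: power2_eq_square)
  qed
  have "(nonbacktracking M *\<^sub>v vec (k\<^sup>2) (\<lambda>e. W (e div k) (e mod k))) $ (i * k + j)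
     = (\<Sum>e<k * k. nonbacktracking M $$ (i * k + j, e) * W (e div k) (e mod k))"
    using nonbacktracking_carrier[OF M] bound[OF ij]
    by (auto simp: scalar_prod_def power2_eq_square lessThan_atLeast0 intro!: sum.cong)
  also have "\<dots> = (\<Sum>u<k. \<Sum>v<k. (if j = u \<and> i \<noteq> v then M $$ (u, v) else 0) * W u v)"
    unfolding sum_lessThan_mult
    by (intro sum.cong refl arg_cong2[where f = "(*)"])
       (use nonbacktracking_index[OF M ij] in auto)
  also have "\<dots> = (\<Sum>u<k. if j = u then (\<Sum>v<k. (if i \<noteq> v then M $$ (u, v) * W u v else 0)) else 0)"
  proof (intro sum.cong refl)
    fix u
    show "(\<Sum>v<k. (if j = u \<and> i \<noteq> v then M $$ (u, v) else 0) * W u v)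
        = (if j = u then (\<Sum>v<k. (if i \<noteq> v then M $$ (u, v) * W u v else 0)) else 0)"
      by (cases "j = u") (auto intro!: sum.cong)
  qed
  also have "\<dots> = (\<Sum>v<k. M $$ (j, v) * W j v - (if i = v then M $$ (j, v) * W j v else 0))"
    using ij by (auto intro!: sum.cong)
  also have "\<dots> = (\<Sum>v<k. M $$ (j, v) * W j v) - M $$ (j, i) * W j i"
    using ij by (simp add: sum_subtractf)
  finally show ?thesis .
qed

text \<open>The part of the Ihara--Bass correspondence that is needed: a null vector $v$ lifts to an
  eigenvector $W$ of $B$.  If $B W = t W$ and $v_j = \sum_l H_{jl} W_{jl}$, then
  $t W_{ij} + H_{ji} W_{ji} = v_j$ for all $i, j$; solving the two equations for $(i,j)$ and
  $(j,i)$ for $W_{ij}$ gives the formula for $W$ below.  Conversely, for this $W$ the identity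
  $v_j = \sum_l H_{jl} W_{jl}$ is exactly the kernel equation, and it also shows $W \neq 0$.\<close>

lemma bethe_hessian_kernel_eigenvalue:
  assumes M: "M \<in> carrier_mat k k" and H: "\<And>i j. i < k \<Longrightarrow> j < k \<Longrightarrow> H i j = M $$ (i, j)"
    and herm: "\<And>i j. i < k \<Longrightarrow> j < k \<Longrightarrow> H j i = cnj (H i j)"
    and h: "\<And>i j. i < k \<Longrightarrow> j < k \<Longrightarrow> cmod (H i j) < t"
    and ker: "\<And>i. i < k \<Longrightarrow> (\<Sum>j<k. bethe_hessian k H t i j * v j) = 0"
    and v: "i0 < k" "v i0 \<noteq> 0"
  shows "eigenvalue (nonbacktracking M) (complex_of_real t)"
proof -
  define d where "d i j = complex_of_real (t\<^sup>2 - (cmod (H i j))\<^sup>2)" for i j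
  have d0: "d i j \<noteq> 0" if "i < k" "j < k" for i j
  proof -
    have "(cmod (H i j))\<^sup>2 < t\<^sup>2" using h[OF that] by (intro power_strict_mono) auto
    then show ?thesis unfolding d_def by (metis diff_gt_0_iff_gt less_irrefl of_real_eq_0_iff)
  qed
  have dsym: "d j i = d i j" if "i < k" "j < k" for i j
    using herm[OF that] by (simp add: d_def)
  have HH: "H i j * H j i = of_real t * of_real t - d i j" if "i < k" "j < k" for i j
    using herm[OF that] complex_norm_square[of "H i j"] by (simp add: d_def power2_eq_square)
  define W where "W i j = (of_real t * v j - H j i * v i) / d i j" for i j
  have S: "(\<Sum>l<k. H j l * W j l) = v j" if j: "j < k" for j
  proof -
    let ?m = "\<Sum>l<k. (cmod (H j l))\<^sup>2 / (t\<^sup>2 - (cmod (H j l))\<^sup>2)"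
    have "(\<Sum>l<k. bethe_hessian k H t j l * v l)
       = (\<Sum>l<k. (if j = l then of_real (1 + ?m) * v l else 0) - of_real t * H j l / d j l * v l)"
      unfolding bethe_hessian_def d_def by (intro sum.cong refl) (simp add: algebra_simps)
    also have "\<dots> = of_real (1 + ?m) * v j - (\<Sum>l<k. of_real t * H j l / d j l * v l)"
      using j by (simp add: sum_subtractf)
    finally have diff0: "0 = of_real (1 + ?m) * v j - (\<Sum>l<k. of_real t * H j l / d j l * v l)"
      unfolding ker[OF j] .
    have ker': "(\<Sum>l<k. of_real t * H j l / d j l * v l) = of_real (1 + ?m) * v j"
      by (rule sym, rule iffD2[OF eq_iff_diff_eq_0], rule sym, rule diff0)
    have "(\<Sum>l<k. H j l * W j l)
       = (\<Sum>l<k. of_real t * H j l / d j l * v l - (of_real ((cmod (H j l))\<^sup>2) / d j l) * v j)"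
    proof (intro sum.cong refl)
      fix l assume "l \<in> {..<k}"
      then have l: "l < k" by simp
      have "H j l * H l j = of_real ((cmod (H j l))\<^sup>2)"
        using herm[OF j l] by (simp add: complex_norm_square del: of_real_power)
      moreover have "H j l * W j l = of_real t * H j l / d j l * v l - (H j l * H l j / d j l) * v j"
        unfolding W_def by (simp add: right_diff_distrib diff_divide_distrib mult_ac)
      ultimately show "H j l * W j l = of_real t * H j l / d j l * v l - (of_real ((cmod (H j l))\<^sup>2) / d j l) * v j"
        by (simp only:)
    qed
    also have "\<dots> = of_real (1 + ?m) * v j - of_real ?m * v j"
    proof -
      have "(\<Sum>l<k. (of_real ((cmod (H j l))\<^sup>2) / d j l) * v j) = of_real ?m * v j"
        by (simp add: d_def sum_distrib_right)
      then show ?thesis unfolding sum_subtractf ker' by (simp only:)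
    qed
    finally show ?thesis by (simp add: algebra_simps)
  qed
  have rel: "of_real t * W i j + H j i * W j i = v j" if ij: "i < k" "j < k" for i j
  proof -
    have "of_real t * W i j + H j i * W j i
        = (of_real t * (of_real t * v j - H j i * v i) + H j i * (of_real t * v i - H i j * v j)) / d i j"
      unfolding W_def dsym[OF ij] by (simp only: add_divide_distrib times_divide_eq_right)
    also have "\<dots> = (of_real t * of_real t - H j i * H i j) * v j / d i j"
      by (simp add: algebra_simps)
    also have "\<dots> = v j" using HH[OF ij(2,1)] d0[OF ij] dsym[OF ij] by simp
    finally show ?thesis .
  qed
  let ?w = "vec (k\<^sup>2) (\<lambda>e. W (e div k) (e mod k))"
  have k: "0 < k" using v by simp
  have "?w \<noteq> 0\<^sub>v (k\<^sup>2)"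
  proof
    assume w0: "?w = 0\<^sub>v (k\<^sup>2)"
    have "W i0 l = 0" if "l < k" for l
    proof -
      have "i0 * k + l < Suc i0 * k" using that by simp
      also have "\<dots> \<le> k * k" using v by (intro mult_le_mono1) simp
      finally have "i0 * k + l < k\<^sup>2" by (simp add: power2_eq_square)
      then show ?thesis using arg_cong[OF w0, of "\<lambda>w. w $ (i0 * k + l)"] that by simp
    qed
    then show False using S[OF v(1)] v(2) by simp
  qed
  moreover have "nonbacktracking M *\<^sub>v ?w = of_real t \<cdot>\<^sub>v ?w"
  proof (rule eq_vecI)
    fix e assume "e < dim_vec (of_real t \<cdot>\<^sub>v ?w)"
    then have e: "e < k * k" by (simp add: power2_eq_square)
    define i j where "i = e div k" and "j = e mod k"
    have ij: "i < k" "j < k" using e k by (simp_all add: i_def j_def less_mult_imp_div_less)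
    have e_eq: "e = i * k + j" by (simp add: i_def j_def)
    have "(nonbacktracking M *\<^sub>v ?w) $ e = (\<Sum>v<k. M $$ (j, v) * W j v) - M $$ (j, i) * W j i"
      unfolding e_eq by (rule nonbacktracking_mult_pairs[OF M ij])
    also have "\<dots> = (\<Sum>v<k. H j v * W j v) - H j i * W j i"
      using H ij by (intro arg_cong2[where f = "(-)"] sum.cong) auto
    also have "\<dots> = of_real t * W i j"
      using rel[OF ij] unfolding S[OF ij(2)] by (simp add: algebra_simps)
    also have "\<dots> = (of_real t \<cdot>\<^sub>v ?w) $ e"
      using e by (simp add: i_def j_def power2_eq_square)
    finally show "(nonbacktracking M *\<^sub>v ?w) $ e = (of_real t \<cdot>\<^sub>v ?w) $ e" .
  qed (use nonbacktracking_carrier[OF M] in auto)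
  ultimately show ?thesis
    using nonbacktracking_carrier[OF M] unfolding eigenvalue_def eigenvector_def
    by (intro exI[of _ ?w]) auto
qed

lemma qform_bethe_hessian:
  "qform k (bethe_hessian k H t) v
   = (\<Sum>i<k. (1 + (\<Sum>l<k. (cmod (H i l))\<^sup>2 / (t\<^sup>2 - (cmod (H i l))\<^sup>2))) * (cmod (v i))\<^sup>2)
     - Re (\<Sum>i<k. \<Sum>j<k. cnj (v i) * (of_real t * H i j / of_real (t\<^sup>2 - (cmod (H i j))\<^sup>2)) * v j)"
proof -
  let ?m = "\<lambda>i. 1 + (\<Sum>l<k. (cmod (H i l))\<^sup>2 / (t\<^sup>2 - (cmod (H i l))\<^sup>2))"
  let ?g = "\<lambda>i j. of_real t * H i j / of_real (t\<^sup>2 - (cmod (H i j))\<^sup>2)"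
  have "(\<Sum>i<k. \<Sum>j<k. cnj (v i) * bethe_hessian k H t i j * v j)
      = (\<Sum>i<k. \<Sum>j<k. (if i = j then of_real (?m i * (cmod (v i))\<^sup>2) else 0)
           - cnj (v i) * ?g i j * v j)"
  proof (intro sum.cong refl)
    fix i j
    have "of_real (?m i * (cmod (v i))\<^sup>2) = cnj (v i) * of_real (?m i) * v i"
      by (simp only: of_real_mult complex_norm_square mult_ac)
    then show "cnj (v i) * bethe_hessian k H t i j * v j
        = (if i = j then of_real (?m i * (cmod (v i))\<^sup>2) else 0) - cnj (v i) * ?g i j * v j"
      unfolding bethe_hessian_def by (simp only: right_diff_distrib left_diff_distrib) auto
  qed
  also have "\<dots> = of_real (\<Sum>i<k. ?m i * (cmod (v i))\<^sup>2) - (\<Sum>i<k. \<Sum>j<k. cnj (v i) * ?g i j * v j)"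
    by (simp add: sum_subtractf)
  finally show ?thesis unfolding qform_def by (simp only: minus_complex.sel Re_complex_of_real)
qed

text \<open>The diagonal matrix $M(t)$ dominates the identity, while the entries of $H(t)$ are of order
  $h / t$, so that $H(t)$ has small norm for large $t$.\<close>

lemma bethe_hessian_pos_def_large:
  assumes h: "\<And>i j. i < k \<Longrightarrow> j < k \<Longrightarrow> cmod (H i j) \<le> h" and h0: "0 < h"
    and t: "h * (real k + 1) < t" and v: "0 < norm_sq k v"
  shows "0 < qform k (bethe_hessian k H t) v"
proof -
  have "h * 1 \<le> h * (real k + 1)" using h0 by (intro mult_left_mono) auto
  then have ht: "h < t" using t by simp
  then have d: "0 < t\<^sup>2 - h\<^sup>2" using h0 by (simp add: power_strict_mono)
  define c where "c = t * h / (t\<^sup>2 - h\<^sup>2)"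
  have dle: "t\<^sup>2 - h\<^sup>2 \<le> t\<^sup>2 - (cmod (H i j))\<^sup>2" if "i < k" "j < k" for i j
    using h[OF that] by (simp add: power_mono)
  let ?g = "\<lambda>i j. of_real t * H i j / of_real (t\<^sup>2 - (cmod (H i j))\<^sup>2)"
  have g: "cmod (?g i j) \<le> c" if "i < k" "j < k" for i j
  proof -
    have "cmod (?g i j) = t * cmod (H i j) / (t\<^sup>2 - (cmod (H i j))\<^sup>2)"
      using dle[OF that] d ht h0 by (simp add: norm_divide norm_mult del: of_real_diff of_real_power)
    also have "\<dots> \<le> c" unfolding c_def
      using dle[OF that] d ht h0 h[OF that] by (intro frac_le mult_left_mono) auto
    finally show ?thesis .
  qed
  have c0: "0 \<le> c" unfolding c_def using d ht h0 by simp
  have "Re (\<Sum>i<k. \<Sum>j<k. cnj (v i) * ?g i j * v j) \<le> (\<Sum>i<k. \<Sum>j<k. cmod (cnj (v i) * ?g i j * v j))"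
    by (rule order_trans[OF complex_Re_le_cmod]) (intro order_trans[OF norm_sum] sum_mono order_refl)
  also have "\<dots> \<le> (\<Sum>i<k. \<Sum>j<k. c * (((cmod (v i))\<^sup>2 + (cmod (v j))\<^sup>2) / 2))"
  proof (intro sum_mono)
    fix i j assume ij: "i \<in> {..<k}" "j \<in> {..<k}"
    have "cmod (cnj (v i) * ?g i j * v j) = cmod (?g i j) * (cmod (v i) * cmod (v j))"
      by (simp only: norm_mult complex_mod_cnj mult_ac)
    also have "\<dots> \<le> c * (cmod (v i) * cmod (v j))"
      using g[of i j] ij by (intro mult_right_mono) auto
    also have "\<dots> \<le> c * (((cmod (v i))\<^sup>2 + (cmod (v j))\<^sup>2) / 2)"
      using sum_squares_bound[of "cmod (v i)" "cmod (v j)"] c0 by (intro mult_left_mono) auto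
    finally show "cmod (cnj (v i) * ?g i j * v j) \<le> \<dots>" .
  qed
  also have "\<dots> = c * real k * norm_sq k v"
    by (simp add: sum_distrib_left[symmetric] sum_divide_distrib[symmetric] sum.distrib norm_sq_def)
  also have "\<dots> < 1 * norm_sq k v"
  proof (intro mult_strict_right_mono v)
    have "t * (h * (real k + 1)) < t * t" using t ht h0 by (intro mult_strict_left_mono) auto
    moreover have "h * h \<le> t * h" using ht h0 by (intro mult_right_mono) auto
    ultimately show "c * real k < 1"
      using d unfolding c_def by (simp add: field_simps power2_eq_square)
  qed
  also have "1 * norm_sq k v \<le> (\<Sum>i<k. (1 + (\<Sum>l<k. (cmod (H i l))\<^sup>2 / (t\<^sup>2 - (cmod (H i l))\<^sup>2))) * (cmod (v i))\<^sup>2)"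
    unfolding norm_sq_def sum_distrib_left
  proof (intro sum_mono mult_right_mono)
    fix i assume "i \<in> {..<k}"
    then have "0 \<le> (\<Sum>l<k. (cmod (H i l))\<^sup>2 / (t\<^sup>2 - (cmod (H i l))\<^sup>2))"
      using order_trans[OF less_imp_le[OF d] dle] by (intro sum_nonneg divide_nonneg_nonneg) simp_all
    then show "1 \<le> 1 + (\<Sum>l<k. (cmod (H i l))\<^sup>2 / (t\<^sup>2 - (cmod (H i l))\<^sup>2))" by simp
  qed auto
  finally show ?thesis unfolding qform_bethe_hessian by simp
qed

text \<open>No $t$ above both thresholds can make the matrix singular, because $t$ would be an eigenvalue
  of $B$ exceeding its spectral radius.\<close>

lemma bethe_hessian_pos_def:
  assumes M: "M \<in> carrier_mat k k" and H: "\<And>i j. i < k \<Longrightarrow> j < k \<Longrightarrow> H i j = M $$ (i, j)"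
    and herm: "\<And>i j. i < k \<Longrightarrow> j < k \<Longrightarrow> H j i = cnj (H i j)"
    and h: "\<And>i j. i < k \<Longrightarrow> j < k \<Longrightarrow> cmod (H i j) \<le> h" and h0: "0 < h"
    and t: "h < t" "spectral_radius (nonbacktracking M) < t"
    and v: "0 < norm_sq k v"
  shows "0 < qform k (bethe_hessian k H t) v"
proof -
  have "0 < k" using v by (cases k) (auto simp: norm_sq_def)
  define b where "b = max t (h * (real k + 1) + 1)"
  have hs: "cmod (H i j) < s" if "i < k" "j < k" "s \<in> {t..b}" for i j s
    using h[OF that(1,2)] t that(3) by simp
  show ?thesis
  proof (rule pos_def_continuation[where A = "bethe_hessian k H" and a = t and b = b])
    show "t \<le> b" by (simp add: b_def)
  next
    fix s i j assume ij: "i < k" "j < k"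
    show "bethe_hessian k H s j i = cnj (bethe_hessian k H s i j)"
      unfolding bethe_hessian_def herm[OF ij] by simp
  next
    fix i j assume ij: "i < k" "j < k"
    have nz: "s\<^sup>2 - (cmod (H i l))\<^sup>2 \<noteq> 0" if "l < k" "s \<in> {t..b}" for l s
    proof -
      have "(cmod (H i l))\<^sup>2 < s\<^sup>2" using hs[OF ij(1) that] by (intro power_strict_mono) auto
      then show ?thesis by simp
    qed
    have "continuous_on {t..b} (\<lambda>s. of_real (1 + (\<Sum>l<k. (cmod (H i l))\<^sup>2 / (s\<^sup>2 - (cmod (H i l))\<^sup>2))) :: complex)"
      by (intro continuous_intros ballI nz) simp_all
    moreover have "continuous_on {t..b} (\<lambda>s. of_real s * H i j / of_real (s\<^sup>2 - (cmod (H i j))\<^sup>2))"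
      using nz[OF ij(2)] by (intro continuous_intros ballI) (simp only: of_real_eq_0_iff not_False_eq_True)
    ultimately show "continuous_on {t..b} (\<lambda>s. bethe_hessian k H s i j)"
      unfolding bethe_hessian_def by (cases "i = j") (simp_all only: simp_thms if_True if_False continuous_on_diff continuous_on_const)
  next
    fix s x assume s: "s \<in> {t..b}" and ker: "\<And>i. i < k \<Longrightarrow> (\<Sum>j<k. bethe_hessian k H s i j * x j) = 0"
    show "norm_sq k x = 0"
    proof (rule ccontr)
      assume "norm_sq k x \<noteq> 0"
      then obtain i where i: "i < k" "x i \<noteq> 0" by (auto simp: norm_sq_eq_0_iff)
      have "eigenvalue (nonbacktracking M) (complex_of_real s)"
        by (rule bethe_hessian_kernel_eigenvalue[OF M H herm hs[OF _ _ s] ker i])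
      then have "cmod (complex_of_real s) \<in> cmod ` spectrum (nonbacktracking M)"
        unfolding spectrum_def by (intro imageI CollectI)
      then have "cmod (complex_of_real s) \<le> spectral_radius (nonbacktracking M)"
        using spectral_radius_mem_max(2)[OF nonbacktracking_carrier[OF M]] \<open>0 < k\<close> by simp
      then show False using abs_ge_self[of s] s t by simp
    qed
  next
    fix x assume "0 < norm_sq k x"
    then show "0 < qform k (bethe_hessian k H b) x"
      by (intro bethe_hessian_pos_def_large[OF h h0]) (auto simp: b_def)
  qed (rule v)
qed

section \<open>Bipartite weights and the Schur test\<close>

lemma sum_lessThan_add:
  "(\<Sum>i<n + m. f i) = (\<Sum>i<n. f i) + (\<Sum>j<m. f (n + j))" for f :: "nat \<Rightarrow> 'a::comm_monoid_add"
  by (induction m) (simp_all add: add.assoc)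

text \<open>Cauchy--Schwarz, with the weight $K_{ij}$ split evenly between the two factors.\<close>

lemma Schur_test:
  fixes K :: "nat \<Rightarrow> nat \<Rightarrow> real"
  assumes K: "\<And>i j. i < n \<Longrightarrow> j < m \<Longrightarrow> 0 \<le> K i j"
    and row: "\<And>i. i < n \<Longrightarrow> (\<Sum>j<m. K i j) \<le> r"
    and col: "\<And>j. j < m \<Longrightarrow> (\<Sum>i<n. K i j) \<le> c"
    and "0 \<le> r" "0 \<le> c"
  shows "(\<Sum>i<n. \<Sum>j<m. K i j * (cmod (u i) * cmod (v j)))
       \<le> sqrt (r * c) * (sqrt (norm_sq n u) * sqrt (norm_sq m v))"
proof -
  let ?P = "{..<n} \<times> {..<m}"
  let ?a = "\<lambda>(i, j). sqrt (K i j) * cmod (u i)" and ?b = "\<lambda>(i, j). sqrt (K i j) * cmod (v j)"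
  have "(\<Sum>i<n. \<Sum>j<m. K i j * (cmod (u i) * cmod (v j))) = (\<Sum>p\<in>?P. ?a p * ?b p)"
    unfolding sum.cartesian_product using K by (auto intro!: sum.cong)
  also have "\<dots> \<le> sqrt ((\<Sum>p\<in>?P. (?a p)\<^sup>2) * (\<Sum>p\<in>?P. (?b p)\<^sup>2))"
    by (rule real_le_rsqrt, rule Cauchy_Schwarz_ineq_sum)
  also have "\<dots> \<le> sqrt ((r * norm_sq n u) * (c * norm_sq m v))"
  proof (intro real_sqrt_le_mono mult_mono)
    have "(\<Sum>p\<in>?P. (?a p)\<^sup>2) = (\<Sum>i<n. \<Sum>j<m. K i j * (cmod (u i))\<^sup>2)"
      unfolding sum.cartesian_product using K by (auto simp: power_mult_distrib intro!: sum.cong)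
    also have "\<dots> = (\<Sum>i<n. (\<Sum>j<m. K i j) * (cmod (u i))\<^sup>2)" by (simp add: sum_distrib_right)
    also have "\<dots> \<le> r * norm_sq n u" unfolding norm_sq_def sum_distrib_left
      using row by (intro sum_mono mult_right_mono) auto
    finally show "(\<Sum>p\<in>?P. (?a p)\<^sup>2) \<le> r * norm_sq n u" .
    have "(\<Sum>p\<in>?P. (?b p)\<^sup>2) = (\<Sum>i<n. \<Sum>j<m. K i j * (cmod (v j))\<^sup>2)"
      unfolding sum.cartesian_product using K by (auto simp: power_mult_distrib intro!: sum.cong)
    also have "\<dots> = (\<Sum>j<m. (\<Sum>i<n. K i j) * (cmod (v j))\<^sup>2)"
      by (subst sum.swap) (simp add: sum_distrib_right)
    also have "\<dots> \<le> c * norm_sq m v" unfolding norm_sq_def sum_distrib_left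
      using col by (intro sum_mono mult_right_mono) auto
    finally show "(\<Sum>p\<in>?P. (?b p)\<^sup>2) \<le> c * norm_sq m v" .
  qed (use assms norm_sq_nonneg in \<open>auto intro!: sum_nonneg mult_nonneg_nonneg\<close>)
  also have "\<dots> = sqrt (r * c) * (sqrt (norm_sq n u) * sqrt (norm_sq m v))"
    by (simp add: real_sqrt_mult mult_ac)
  finally show ?thesis .
qed

text \<open>The Hermitization of $X$, as a function on indices like the matrices in the continuation
  argument.\<close>

definition bipartite :: "nat \<Rightarrow> (nat \<Rightarrow> nat \<Rightarrow> complex) \<Rightarrow> nat \<Rightarrow> nat \<Rightarrow> complex" where
  "bipartite n X i j =
     (if i < n then if j < n then 0 else X i (j - n) else if j < n then cnj (X j (i - n)) else 0)"

text \<open>The scalars $a$ and $b$ weight the two sides of the bipartition against each other; they are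
  chosen optimally in the next estimate.\<close>

lemma qform_bethe_hessian_bipartite:
  fixes a b t :: real and u v :: "nat \<Rightarrow> complex" and n m :: nat
  defines "z \<equiv> \<lambda>i. if i < n then of_real a * u i else of_real b * v (i - n)"
  shows "qform (n + m) (bethe_hessian (n + m) (bipartite n X) t) z
   = a\<^sup>2 * (\<Sum>i<n. (1 + (\<Sum>j<m. (cmod (X i j))\<^sup>2 / (t\<^sup>2 - (cmod (X i j))\<^sup>2))) * (cmod (u i))\<^sup>2)
     + b\<^sup>2 * (\<Sum>j<m. (1 + (\<Sum>i<n. (cmod (X i j))\<^sup>2 / (t\<^sup>2 - (cmod (X i j))\<^sup>2))) * (cmod (v j))\<^sup>2)
     - 2 * a * b * Re (\<Sum>i<n. \<Sum>j<m. cnj (u i) * (of_real t * X i j / of_real (t\<^sup>2 - (cmod (X i j))\<^sup>2)) * v j)"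
proof -
  let ?G = "\<lambda>i j. of_real t * X i j / of_real (t\<^sup>2 - (cmod (X i j))\<^sup>2)"
  define S where "S = (\<Sum>i<n. \<Sum>j<m. cnj (u i) * ?G i j * v j)"
  have off: "(\<Sum>i<n + m. \<Sum>j<n + m. cnj (z i) * (of_real t * bipartite n X i j /
        of_real (t\<^sup>2 - (cmod (bipartite n X i j))\<^sup>2)) * z j) = of_real (a * b) * (S + cnj S)"
    unfolding sum_lessThan_add S_def z_def bipartite_def
    by (simp add: sum_distrib_left distrib_left mult_ac) (rule sum.swap)
  have diag: "(\<Sum>i<n + m. (1 + (\<Sum>l<n + m. (cmod (bipartite n X i l))\<^sup>2 /
        (t\<^sup>2 - (cmod (bipartite n X i l))\<^sup>2))) * (cmod (z i))\<^sup>2)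
      = a\<^sup>2 * (\<Sum>i<n. (1 + (\<Sum>j<m. (cmod (X i j))\<^sup>2 / (t\<^sup>2 - (cmod (X i j))\<^sup>2))) * (cmod (u i))\<^sup>2)
      + b\<^sup>2 * (\<Sum>j<m. (1 + (\<Sum>i<n. (cmod (X i j))\<^sup>2 / (t\<^sup>2 - (cmod (X i j))\<^sup>2))) * (cmod (v j))\<^sup>2)"
    unfolding sum_lessThan_add z_def bipartite_def
    by (simp add: norm_mult power_mult_distrib sum_distrib_left mult_ac)
  have "Re (of_real (a * b) * (S + cnj S)) = 2 * a * b * Re S" by simp
  then show ?thesis
    unfolding qform_bethe_hessian diag off S_def by (simp only:)
qed

lemma entrywise_sum_le:
  assumes "\<And>j. j < m \<Longrightarrow> cmod (x j) \<le> h" "0 \<le> h" "h < t" "(\<Sum>j<m. (cmod (x j))\<^sup>2) \<le> r\<^sup>2"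
  shows "(\<Sum>j<m. (cmod (x j))\<^sup>2 / (t\<^sup>2 - (cmod (x j))\<^sup>2)) \<le> r\<^sup>2 / (t\<^sup>2 - h\<^sup>2)"
proof -
  have d: "0 < t\<^sup>2 - h\<^sup>2" using assms by (simp add: power_strict_mono)
  have "(\<Sum>j<m. (cmod (x j))\<^sup>2 / (t\<^sup>2 - (cmod (x j))\<^sup>2)) \<le> (\<Sum>j<m. (cmod (x j))\<^sup>2 / (t\<^sup>2 - h\<^sup>2))"
  proof (intro sum_mono)
    fix j assume "j \<in> {..<m}"
    then have "t\<^sup>2 - h\<^sup>2 \<le> t\<^sup>2 - (cmod (x j))\<^sup>2"
      using assms(1) by (simp add: power_mono)
    then show "(cmod (x j))\<^sup>2 / (t\<^sup>2 - (cmod (x j))\<^sup>2) \<le> (cmod (x j))\<^sup>2 / (t\<^sup>2 - h\<^sup>2)"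
      using d by (intro frac_le) auto
  qed
  also have "\<dots> \<le> r\<^sup>2 / (t\<^sup>2 - h\<^sup>2)"
    using assms(4) d by (simp add: sum_divide_distrib[symmetric] divide_right_mono)
  finally show ?thesis .
qed

text \<open>Testing positivity on $(a u, b v)$ gives
  $2 a b \, \mathrm{Re} \langle u, X(t) v \rangle \le a^2 \mu |u|^2 + b^2 \nu |v|^2$, where $\mu$ and
  $\nu$ bound the diagonal on the two sides.  The weights that equalize the two terms turn this into
  the geometric mean of $\mu$ and $\nu$.  It is this product, instead of the square of the larger
  factor, through which the different sizes of the rows and of the columns of $X$ enter.\<close>

lemma weighted_form_le:
  fixes X :: "nat \<Rightarrow> nat \<Rightarrow> complex"
  assumes pos: "\<And>z. 0 < norm_sq (n + m) z \<Longrightarrow> 0 < qform (n + m) (bethe_hessian (n + m) (bipartite n X) t) z"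
    and h: "\<And>i j. i < n \<Longrightarrow> j < m \<Longrightarrow> cmod (X i j) \<le> h" "0 \<le> h" "h < t"
    and row: "\<And>i. i < n \<Longrightarrow> (\<Sum>j<m. (cmod (X i j))\<^sup>2) \<le> r\<^sup>2"
    and col: "\<And>j. j < m \<Longrightarrow> (\<Sum>i<n. (cmod (X i j))\<^sup>2) \<le> c\<^sup>2"
    and u: "0 < norm_sq n u" and v: "0 < norm_sq m v"
  shows "Re (\<Sum>i<n. \<Sum>j<m. cnj (u i) * (of_real t * X i j / of_real (t\<^sup>2 - (cmod (X i j))\<^sup>2)) * v j)
    \<le> sqrt ((1 + r\<^sup>2 / (t\<^sup>2 - h\<^sup>2)) * (1 + c\<^sup>2 / (t\<^sup>2 - h\<^sup>2))) * (sqrt (norm_sq n u) * sqrt (norm_sq m v))"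
    (is "Re ?S \<le> _")
proof -
  have d: "0 < t\<^sup>2 - h\<^sup>2" using h by (simp add: power_strict_mono)
  define \<mu> where "\<mu> = 1 + r\<^sup>2 / (t\<^sup>2 - h\<^sup>2)"
  define \<nu> where "\<nu> = 1 + c\<^sup>2 / (t\<^sup>2 - h\<^sup>2)"
  have \<mu>: "0 < \<mu>" and \<nu>: "0 < \<nu>" using d by (auto simp: \<mu>_def \<nu>_def intro!: add_pos_nonneg)
  define U where "U = norm_sq n u"
  define V where "V = norm_sq m v"
  define a where "a = sqrt (\<nu> * V)"
  define b where "b = sqrt (\<mu> * U)"
  define z where "z = (\<lambda>i. if i < n then of_real a * u i else of_real b * v (i - n))"
  have ab: "0 < a" "0 < b" "a\<^sup>2 = \<nu> * V" "b\<^sup>2 = \<mu> * U"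
    using \<mu> \<nu> u v by (simp_all add: a_def b_def U_def V_def)
  have "norm_sq (n + m) z = a\<^sup>2 * U + b\<^sup>2 * V"
    unfolding norm_sq_def sum_lessThan_add z_def U_def V_def
    by (simp add: norm_mult power_mult_distrib sum_distrib_left)
  also have "\<dots> > 0" using ab(1,2) u v by (simp add: U_def V_def add_pos_pos)
  finally have "0 < qform (n + m) (bethe_hessian (n + m) (bipartite n X) t) z" by (rule pos)
  then have "2 * a * b * Re ?S
      \<le> a\<^sup>2 * (\<Sum>i<n. (1 + (\<Sum>j<m. (cmod (X i j))\<^sup>2 / (t\<^sup>2 - (cmod (X i j))\<^sup>2))) * (cmod (u i))\<^sup>2)
      + b\<^sup>2 * (\<Sum>j<m. (1 + (\<Sum>i<n. (cmod (X i j))\<^sup>2 / (t\<^sup>2 - (cmod (X i j))\<^sup>2))) * (cmod (v j))\<^sup>2)"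
    unfolding z_def qform_bethe_hessian_bipartite by linarith
  also have "\<dots> \<le> a\<^sup>2 * (\<mu> * U) + b\<^sup>2 * (\<nu> * V)"
  proof (intro add_mono mult_left_mono)
    show "(\<Sum>i<n. (1 + (\<Sum>j<m. (cmod (X i j))\<^sup>2 / (t\<^sup>2 - (cmod (X i j))\<^sup>2))) * (cmod (u i))\<^sup>2) \<le> \<mu> * U"
      unfolding U_def \<mu>_def norm_sq_def sum_distrib_left
      using h row by (intro sum_mono mult_right_mono add_mono entrywise_sum_le order_refl) auto
    show "(\<Sum>j<m. (1 + (\<Sum>i<n. (cmod (X i j))\<^sup>2 / (t\<^sup>2 - (cmod (X i j))\<^sup>2))) * (cmod (v j))\<^sup>2) \<le> \<nu> * V"
      unfolding V_def \<nu>_def norm_sq_def sum_distrib_left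
      using h col by (intro sum_mono mult_right_mono add_mono entrywise_sum_le order_refl) auto
  qed auto
  also have "\<dots> = 2 * a * b * (a * b)"
    using ab(3,4) by (simp add: power2_eq_square algebra_simps)
  finally have "Re ?S \<le> a * b" using ab(1,2) by simp
  also have "a * b = sqrt (\<mu> * \<nu>) * (sqrt U * sqrt V)"
    by (simp add: a_def b_def real_sqrt_mult mult_ac)
  finally show ?thesis unfolding \<mu>_def \<nu>_def U_def V_def .
qed

text \<open>The entries of $X - t X(t)$ are of size $|X_{ij}|^3 / (t^2 - |X_{ij}|^2)$, so the Schur test
  bounds the price of replacing $t X(t)$ by $X$.\<close>

lemma bilinear_form_le:
  fixes X :: "nat \<Rightarrow> nat \<Rightarrow> complex"
  assumes pos: "\<And>z. 0 < norm_sq (n + m) z \<Longrightarrow> 0 < qform (n + m) (bethe_hessian (n + m) (bipartite n X) t) z"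
    and h: "\<And>i j. i < n \<Longrightarrow> j < m \<Longrightarrow> cmod (X i j) \<le> h" "0 \<le> h" "h < t"
    and row: "\<And>i. i < n \<Longrightarrow> (\<Sum>j<m. (cmod (X i j))\<^sup>2) \<le> r\<^sup>2"
    and col: "\<And>j. j < m \<Longrightarrow> (\<Sum>i<n. (cmod (X i j))\<^sup>2) \<le> c\<^sup>2"
    and rc: "0 \<le> r" "0 \<le> c"
    and u: "0 < norm_sq n u" and v: "0 < norm_sq m v"
  shows "Re (\<Sum>i<n. \<Sum>j<m. cnj (u i) * X i j * v j)
    \<le> (t * sqrt ((1 + r\<^sup>2 / (t\<^sup>2 - h\<^sup>2)) * (1 + c\<^sup>2 / (t\<^sup>2 - h\<^sup>2))) + h * r * c / (t\<^sup>2 - h\<^sup>2))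
      * (sqrt (norm_sq n u) * sqrt (norm_sq m v))"
proof -
  have d: "0 < t\<^sup>2 - h\<^sup>2" using h by (simp add: power_strict_mono)
  let ?G = "\<lambda>i j. of_real t * X i j / of_real (t\<^sup>2 - (cmod (X i j))\<^sup>2)"
  define E where "E i j = X i j - of_real t * ?G i j" for i j
  define K where "K i j = (cmod (X i j))\<^sup>2 * (h / (t\<^sup>2 - h\<^sup>2))" for i j
  have E: "cmod (E i j) \<le> K i j" if "i < n" "j < m" for i j
  proof -
    have hij: "(cmod (X i j))\<^sup>2 \<le> h\<^sup>2" using h(1)[OF that] by (simp add: power_mono)
    define D where "D = t\<^sup>2 - (cmod (X i j))\<^sup>2"
    have D: "t\<^sup>2 - h\<^sup>2 \<le> D" "0 < D" using hij d by (auto simp: D_def)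
    have "t * t - D = (cmod (X i j))\<^sup>2" by (simp add: D_def power2_eq_square)
    then have eq: "of_real t * of_real t - of_real D = (of_real ((cmod (X i j))\<^sup>2) :: complex)"
      by (metis of_real_diff of_real_mult)
    have "E i j = - ((of_real t * of_real t - of_real D) * X i j / of_real D)"
      using D(2) unfolding E_def D_def[symmetric] by (simp add: field_simps)
    then have "cmod (E i j) = (cmod (X i j))\<^sup>2 * (cmod (X i j) / D)"
      unfolding eq using D(2) by (simp add: norm_mult norm_divide del: of_real_power)
    also have "\<dots> \<le> K i j"
      unfolding K_def using h(1)[OF that] h(2) D d by (intro mult_left_mono frac_le) auto
    finally show ?thesis .
  qed
  have "Re (\<Sum>i<n. \<Sum>j<m. cnj (u i) * E i j * v j) \<le> (\<Sum>i<n. \<Sum>j<m. cmod (cnj (u i) * E i j * v j))"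
    by (rule order_trans[OF complex_Re_le_cmod]) (intro order_trans[OF norm_sum] sum_mono order_refl)
  also have "\<dots> \<le> (\<Sum>i<n. \<Sum>j<m. K i j * (cmod (u i) * cmod (v j)))"
  proof (intro sum_mono)
    fix i j assume "i \<in> {..<n}" "j \<in> {..<m}"
    then have "cmod (E i j) * (cmod (u i) * cmod (v j)) \<le> K i j * (cmod (u i) * cmod (v j))"
      by (intro mult_right_mono E) auto
    then show "cmod (cnj (u i) * E i j * v j) \<le> K i j * (cmod (u i) * cmod (v j))"
      by (simp add: norm_mult mult_ac)
  qed
  also have "\<dots> \<le> sqrt (r\<^sup>2 * (h / (t\<^sup>2 - h\<^sup>2)) * (c\<^sup>2 * (h / (t\<^sup>2 - h\<^sup>2)))) * (sqrt (norm_sq n u) * sqrt (norm_sq m v))"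
  proof (intro Schur_test)
    have q: "0 \<le> h / (t\<^sup>2 - h\<^sup>2)" using h d by simp
    show "0 \<le> K i j" for i j unfolding K_def using q by (intro mult_nonneg_nonneg) auto
    show "(\<Sum>j<m. K i j) \<le> r\<^sup>2 * (h / (t\<^sup>2 - h\<^sup>2))" if "i < n" for i
      unfolding K_def sum_distrib_right[symmetric] by (intro mult_right_mono row that q)
    show "(\<Sum>i<n. K i j) \<le> c\<^sup>2 * (h / (t\<^sup>2 - h\<^sup>2))" if "j < m" for j
      unfolding K_def sum_distrib_right[symmetric] by (intro mult_right_mono col that q)
    show "0 \<le> r\<^sup>2 * (h / (t\<^sup>2 - h\<^sup>2))" "0 \<le> c\<^sup>2 * (h / (t\<^sup>2 - h\<^sup>2))"
      using mult_nonneg_nonneg[OF zero_le_power2 q] by blast+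
  qed
  also have "r\<^sup>2 * (h / (t\<^sup>2 - h\<^sup>2)) * (c\<^sup>2 * (h / (t\<^sup>2 - h\<^sup>2))) = (h * r * c / (t\<^sup>2 - h\<^sup>2))\<^sup>2"
    by (simp add: power2_eq_square)
  also have "sqrt \<dots> = h * r * c / (t\<^sup>2 - h\<^sup>2)" using h d rc by (simp del: power_divide)
  finally have err: "Re (\<Sum>i<n. \<Sum>j<m. cnj (u i) * E i j * v j)
      \<le> h * r * c / (t\<^sup>2 - h\<^sup>2) * (sqrt (norm_sq n u) * sqrt (norm_sq m v))" .
  have "(\<Sum>i<n. \<Sum>j<m. cnj (u i) * X i j * v j)
      = of_real t * (\<Sum>i<n. \<Sum>j<m. cnj (u i) * ?G i j * v j) + (\<Sum>i<n. \<Sum>j<m. cnj (u i) * E i j * v j)"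
    unfolding E_def sum_distrib_left sum.distrib[symmetric]
    by (intro sum.cong refl) (simp only: right_diff_distrib left_diff_distrib mult_ac, simp)
  then have "Re (\<Sum>i<n. \<Sum>j<m. cnj (u i) * X i j * v j)
      = t * Re (\<Sum>i<n. \<Sum>j<m. cnj (u i) * ?G i j * v j) + Re (\<Sum>i<n. \<Sum>j<m. cnj (u i) * E i j * v j)"
    by (simp only: plus_complex.sel times_complex.sel Re_complex_of_real Im_complex_of_real)
  also have "\<dots> \<le> t * (sqrt ((1 + r\<^sup>2 / (t\<^sup>2 - h\<^sup>2)) * (1 + c\<^sup>2 / (t\<^sup>2 - h\<^sup>2))) * (sqrt (norm_sq n u) * sqrt (norm_sq m v)))
      + h * r * c / (t\<^sup>2 - h\<^sup>2) * (sqrt (norm_sq n u) * sqrt (norm_sq m v))"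
    using h by (intro add_mono mult_left_mono weighted_form_le[OF pos h row col u v] err) auto
  finally show ?thesis by (simp only: distrib_right mult.assoc)
qed

section \<open>Matrix norms and the largest singular value\<close>

lemma mat_adjoint_carrier_index:
  assumes "X \<in> carrier_mat n m"
  shows "mat_adjoint X \<in> carrier_mat m n"
    and "i < m \<Longrightarrow> j < n \<Longrightarrow> mat_adjoint X $$ (i, j) = cnj (X $$ (j, i))"
  using assms by (auto simp: mat_adjoint_def mat_of_rows_def)

lemma norm_1_inf_ge:
  assumes "A \<in> carrier_mat n m" "i < n" "j < m"
  shows "cmod (A $$ (i, j)) \<le> norm_1_inf A"
  unfolding norm_1_inf_def
proof (rule Max_ge)
  have "{cmod (A $$ (i, j)) | i j. i < dim_row A \<and> j < dim_col A}
      = (\<lambda>(i, j). cmod (A $$ (i, j))) ` ({..<dim_row A} \<times> {..<dim_col A})" by auto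
  then show "finite {cmod (A $$ (i, j)) | i j. i < dim_row A \<and> j < dim_col A}" by simp
qed (use assms in auto)

lemma row_norm_le_norm_2_inf:
  assumes "A \<in> carrier_mat n m" "i < n"
  shows "sqrt (\<Sum>j<m. (cmod (A $$ (i, j)))\<^sup>2) \<le> norm_2_inf A"
  unfolding norm_2_inf_def using assms by (intro Max_ge) auto

lemma norm_2_inf_nonneg:
  assumes "A \<in> carrier_mat n m" "0 < n"
  shows "0 \<le> norm_2_inf A"
  by (rule order_trans[OF _ row_norm_le_norm_2_inf[OF assms]]) (simp add: sum_nonneg)

lemma row_sum_le_norm_2_inf_sq:
  assumes "A \<in> carrier_mat n m" "i < n"
  shows "(\<Sum>j<m. (cmod (A $$ (i, j)))\<^sup>2) \<le> (norm_2_inf A)\<^sup>2"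
  using row_norm_le_norm_2_inf[OF assms] by (rule sqrt_le_D)

lemma norm_2_inf_le:
  assumes "A \<in> carrier_mat n m" "0 < n" "\<And>i. i < n \<Longrightarrow> (\<Sum>j<m. (cmod (A $$ (i, j)))\<^sup>2) \<le> b\<^sup>2" "0 \<le> b"
  shows "norm_2_inf A \<le> b"
  unfolding norm_2_inf_def
proof (rule Max.boundedI)
  show "{sqrt (\<Sum>j<dim_col A. (cmod (A $$ (i, j)))\<^sup>2) | i. i < dim_row A} \<noteq> {}" using assms by auto
  fix x assume "x \<in> {sqrt (\<Sum>j<dim_col A. (cmod (A $$ (i, j)))\<^sup>2) | i. i < dim_row A}"
  then show "x \<le> b" using assms by (auto intro!: real_le_lsqrt sum_nonneg)
qed auto

lemma hermitization_carrier_index: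
  assumes X: "X \<in> carrier_mat n m"
  shows "hermitization X \<in> carrier_mat (n + m) (n + m)"
    and "i < n \<Longrightarrow> j < m \<Longrightarrow> hermitization X $$ (i, n + j) = X $$ (i, j)"
    and "i < n + m \<Longrightarrow> j < n + m \<Longrightarrow> hermitization X $$ (i, j) =
       (if i < n then if j < n then 0 else X $$ (i, j - n) else if j < n then cnj (X $$ (j, i - n)) else 0)"
  using X mat_adjoint_carrier_index[OF X]
  by (auto simp: hermitization_def)

text \<open>Pairing $X^* X v = e v$ with $v$ gives $|Xv|^2 = e |v|^2$.\<close>

lemma gram_eigenvector:
  assumes X: "X \<in> carrier_mat n m" and e: "eigenvalue (mat_adjoint X * X) e"
  obtains v where "0 < norm_sq m v"
    "complex_of_real (norm_sq n (\<lambda>i. \<Sum>j<m. X $$ (i, j) * v j)) = e * complex_of_real (norm_sq m v)"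
proof -
  note Xa = mat_adjoint_carrier_index[OF X]
  obtain w where w: "w \<in> carrier_vec m" "w \<noteq> 0\<^sub>v m" and ev: "(mat_adjoint X * X) *\<^sub>v w = e \<cdot>\<^sub>v w"
    using e X Xa unfolding eigenvalue_def eigenvector_def by auto
  define v where "v j = w $ j" for j
  define y where "y i = (\<Sum>j<m. X $$ (i, j) * v j)" for i
  have y: "(X *\<^sub>v w) $ i = y i" if "i < n" for i
    using X w that by (auto simp: y_def v_def scalar_prod_def lessThan_atLeast0 intro!: sum.cong)
  have adj: "(\<Sum>i<n. cnj (X $$ (i, j)) * y i) = e * v j" if "j < m" for j
  proof -
    have "(\<Sum>i<n. cnj (X $$ (i, j)) * y i) = (mat_adjoint X *\<^sub>v (X *\<^sub>v w)) $ j"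
      using X Xa w that y by (auto simp: scalar_prod_def lessThan_atLeast0 simp del: index_mult_mat_vec(1)[of _ X] intro!: sum.cong)
    also have "mat_adjoint X *\<^sub>v (X *\<^sub>v w) = e \<cdot>\<^sub>v w"
      using assoc_mult_mat_vec[OF Xa(1) X w(1)] ev by simp
    finally show ?thesis using w that by (simp add: v_def)
  qed
  have "complex_of_real (norm_sq n y) = (\<Sum>i<n. cnj (y i) * y i)"
    by (simp add: norm_sq_def complex_norm_square mult.commute del: of_real_power)
  also have "\<dots> = (\<Sum>i<n. \<Sum>j<m. cnj (v j) * (cnj (X $$ (i, j)) * y i))"
  proof (intro sum.cong refl)
    fix i
    have "cnj (y i) = (\<Sum>j<m. cnj (v j) * cnj (X $$ (i, j)))" by (simp add: y_def mult.commute)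
    then show "cnj (y i) * y i = (\<Sum>j<m. cnj (v j) * (cnj (X $$ (i, j)) * y i))"
      by (simp only: sum_distrib_right mult.assoc)
  qed
  also have "\<dots> = (\<Sum>j<m. cnj (v j) * (\<Sum>i<n. cnj (X $$ (i, j)) * y i))"
    by (subst sum.swap) (simp add: sum_distrib_left)
  also have "\<dots> = (\<Sum>j<m. e * of_real ((cmod (v j))\<^sup>2))"
  proof (intro sum.cong refl)
    fix j assume "j \<in> {..<m}"
    then show "cnj (v j) * (\<Sum>i<n. cnj (X $$ (i, j)) * y i) = e * of_real ((cmod (v j))\<^sup>2)"
      unfolding complex_norm_square by (subst adj) (simp_all only: lessThan_iff mult_ac)
  qed
  also have "\<dots> = e * complex_of_real (norm_sq m v)"
    by (simp add: norm_sq_def sum_distrib_left)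
  finally have eq: "complex_of_real (norm_sq n y) = e * complex_of_real (norm_sq m v)" .
  have "norm_sq m v \<noteq> 0"
  proof
    assume "norm_sq m v = 0"
    then have "w = 0\<^sub>v m" using w(1) by (intro eq_vecI) (auto simp: norm_sq_eq_0_iff v_def)
    then show False using w(2) by simp
  qed
  then have "0 < norm_sq m v" using norm_sq_nonneg[of m v] by simp
  then show ?thesis using eq unfolding y_def by (rule that)
qed

text \<open>A maximum is informative only for a finite nonempty set.  Finiteness comes from
  the spectrum of $X^* X$, and nonemptiness from the fact that all its eigenvalues are nonnegative
  reals.\<close>

lemma sigma_max_attained:
  assumes X: "X \<in> carrier_mat n m" and m: "0 < m"
  obtains v where "0 < norm_sq m v" "0 \<le> sigma_max X"
    "norm_sq n (\<lambda>i. \<Sum>j<m. X $$ (i, j) * v j) = (sigma_max X)\<^sup>2 * norm_sq m v"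
proof -
  have G: "mat_adjoint X * X \<in> carrier_mat m m"
    using X mat_adjoint_carrier_index(1)[OF X] by auto
  have "singular_values X \<subseteq> (\<lambda>e. sqrt (Re e)) ` spectrum (mat_adjoint X * X)"
  proof
    fix s assume "s \<in> singular_values X"
    then show "s \<in> (\<lambda>e. sqrt (Re e)) ` spectrum (mat_adjoint X * X)"
      by (intro image_eqI[of _ _ "complex_of_real (s\<^sup>2)"]) (simp_all add: singular_values_def spectrum_def)
  qed
  then have fin: "finite (singular_values X)"
    using card_finite_spectrum(1)[OF G] finite_surj by blast
  have "singular_values X \<noteq> {}"
  proof -
    obtain e where e: "eigenvalue (mat_adjoint X * X) e"
      using spectrum_non_empty[OF G m] by (auto simp: spectrum_def)
    obtain v where v: "0 < norm_sq m v"
      "complex_of_real (norm_sq n (\<lambda>i. \<Sum>j<m. X $$ (i, j) * v j)) = e * complex_of_real (norm_sq m v)"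
      by (rule gram_eigenvector[OF X e])
    define q where "q = norm_sq n (\<lambda>i. \<Sum>j<m. X $$ (i, j) * v j) / norm_sq m v"
    have "e = complex_of_real q" using v unfolding q_def by (simp add: field_simps)
    moreover have "0 \<le> q" unfolding q_def by (simp add: norm_sq_nonneg)
    ultimately have "sqrt q \<in> singular_values X" using e by (simp add: singular_values_def flip: of_real_power)
    then show ?thesis by blast
  qed
  then have s: "0 \<le> sigma_max X" "eigenvalue (mat_adjoint X * X) (complex_of_real ((sigma_max X)\<^sup>2))"
    using Max_in[OF fin] by (auto simp: sigma_max_def singular_values_def)
  obtain v where v: "0 < norm_sq m v"
    "complex_of_real (norm_sq n (\<lambda>i. \<Sum>j<m. X $$ (i, j) * v j)) = complex_of_real ((sigma_max X)\<^sup>2) * complex_of_real (norm_sq m v)"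
    by (rule gram_eigenvector[OF X s(2)])
  show ?thesis
    using v(2) by (intro that[OF v(1) s(1)]) (simp only: of_real_mult[symmetric] of_real_eq_iff)
qed

text \<open>Here $u = X v$ for a top right singular vector $v$, so that the bilinear form equals
  $\sigma_{\max} |u| |v|$.\<close>

lemma singular_value_bound:
  assumes X: "X \<in> carrier_mat n m" and X0: "X \<noteq> 0\<^sub>m n m"
    and t: "norm_1_inf (hermitization X) < t" "spectral_radius (nonbacktracking (hermitization X)) < t"
  defines "h \<equiv> norm_1_inf (hermitization X)"
    and "r \<equiv> norm_2_inf X" and "c \<equiv> norm_2_inf (mat_adjoint X)"
  shows "sigma_max X \<le> t * sqrt ((1 + r\<^sup>2 / (t\<^sup>2 - h\<^sup>2)) * (1 + c\<^sup>2 / (t\<^sup>2 - h\<^sup>2))) + h * r * c / (t\<^sup>2 - h\<^sup>2)"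
    (is "_ \<le> ?T")
proof -
  let ?H = "hermitization X"
  note H = hermitization_carrier_index[OF X] and Xa = mat_adjoint_carrier_index[OF X]
  define x where "x i j = X $$ (i, j)" for i j
  obtain i0 j0 where ij0: "i0 < n" "j0 < m" "X $$ (i0, j0) \<noteq> 0"
    using X X0 by (metis carrier_matD eq_matI index_zero_mat)
  have hH: "cmod (?H $$ (i, j)) \<le> h" if "i < n + m" "j < n + m" for i j
    unfolding h_def by (rule norm_1_inf_ge[OF H(1) that])
  have hx: "cmod (x i j) \<le> h" if "i < n" "j < m" for i j
    using hH[of i "n + j"] H(2)[OF that] that by (simp add: x_def)
  have h0: "0 < h" using hx[OF ij0(1,2)] ij0(3) unfolding x_def by (smt (verit) zero_less_norm_iff)
  have bip: "bipartite n x i j = ?H $$ (i, j)" if "i < n + m" "j < n + m" for i j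
    using H(3)[OF that] by (simp add: bipartite_def x_def)
  have pos: "0 < qform (n + m) (bethe_hessian (n + m) (bipartite n x) t) z" if "0 < norm_sq (n + m) z" for z
  proof (rule bethe_hessian_pos_def[OF H(1) bip _ _ h0 _ t(2) that])
    show "bipartite n x j i = cnj (bipartite n x i j)" for i j by (simp add: bipartite_def)
    show "cmod (bipartite n x i j) \<le> h" if "i < n + m" "j < n + m" for i j
      using hH bip that by simp
    show "h < t" using t(1) by (simp add: h_def)
  qed
  have rc: "0 \<le> r" "0 \<le> c"
    unfolding r_def c_def using norm_2_inf_nonneg[OF X] norm_2_inf_nonneg[OF Xa(1)] ij0 by auto
  have row: "(\<Sum>j<m. (cmod (x i j))\<^sup>2) \<le> r\<^sup>2" if "i < n" for i
    unfolding r_def x_def by (rule row_sum_le_norm_2_inf_sq[OF X that])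
  have col: "(\<Sum>i<n. (cmod (x i j))\<^sup>2) \<le> c\<^sup>2" if "j < m" for j
    using row_sum_le_norm_2_inf_sq[OF Xa(1) that] Xa(2) that by (simp add: c_def x_def)
  have d: "0 < t\<^sup>2 - h\<^sup>2" using t(1) h0 by (simp add: h_def power_strict_mono)
  have T0: "0 \<le> ?T"
    using d rc h0 t(1) by (intro add_nonneg_nonneg mult_nonneg_nonneg divide_nonneg_nonneg) (auto simp: h_def)
  have m: "0 < m" using ij0 by simp
  obtain v where v: "0 < norm_sq m v" and \<sigma>0: "0 \<le> sigma_max X"
    and \<sigma>: "norm_sq n (\<lambda>i. \<Sum>j<m. X $$ (i, j) * v j) = (sigma_max X)\<^sup>2 * norm_sq m v"
    by (rule sigma_max_attained[OF X m])
  show ?thesis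
  proof (cases "sigma_max X = 0")
    case True
    then show ?thesis using T0 by simp
  next
    case False
    define u where "u i = (\<Sum>j<m. x i j * v j)" for i
    have U: "norm_sq n u = (sigma_max X)\<^sup>2 * norm_sq m v" using \<sigma> by (simp add: u_def[abs_def] x_def)
    then have u: "0 < norm_sq n u" using False v by simp
    have "norm_sq n u = Re (\<Sum>i<n. \<Sum>j<m. cnj (u i) * x i j * v j)"
    proof -
      have "(\<Sum>i<n. \<Sum>j<m. cnj (u i) * x i j * v j) = (\<Sum>i<n. cnj (u i) * u i)"
        unfolding u_def[of i for i] by (simp add: sum_distrib_left mult.assoc)
      also have "\<dots> = of_real (norm_sq n u)"
        by (simp add: norm_sq_def complex_norm_square mult.commute del: of_real_power)
      finally show ?thesis by simp
    qed
    also have "\<dots> \<le> ?T * (sqrt (norm_sq n u) * sqrt (norm_sq m v))"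
      using t(1) h0 by (intro bilinear_form_le[OF pos hx _ _ row col rc u v]) (auto simp: h_def)
    also have "sqrt (norm_sq n u) * sqrt (norm_sq m v) = sigma_max X * norm_sq m v"
      unfolding U using \<sigma>0 v by (simp add: real_sqrt_mult)
    finally have "sigma_max X * (sigma_max X * norm_sq m v) \<le> ?T * (sigma_max X * norm_sq m v)"
      unfolding U by (simp add: power2_eq_square mult.assoc)
    then show ?thesis using False \<sigma>0 v by (simp add: mult_le_cancel_right)
  qed
qed

section \<open>The scalar estimates and the conclusion\<close>

text \<open>In the application $y$ and $\eta$ are the truncated spectral radius and the largest entry,
  both divided by $\|H\|_{2,\infty}$, and $s = \gamma^{1/2}$.  Expanding the square, the term of
  order $\eta^0$ is the main term; the term of order $\eta^2$ is controlled by
  $1 / y^2 \le 1 / s$.\<close>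

lemma deviation_scalar_bound:
  fixes s y \<eta> :: real
  assumes s: "0 < s" "s \<le> 1" and y: "0 < y" "s \<le> y\<^sup>2" and \<eta>: "0 \<le> \<eta>"
  shows "(sqrt ((y\<^sup>2 + \<eta>\<^sup>2) * ((1 + 1 / y\<^sup>2) * (1 + s\<^sup>2 / y\<^sup>2))) + \<eta> * (s / y\<^sup>2))\<^sup>2
    \<le> (y + 1 / y) * (y + s\<^sup>2 / y) + 2 * (y + 1 / y) * \<eta> + 9 / s * \<eta>\<^sup>2"
proof -
  define w where "w = 1 / y\<^sup>2"
  have w: "0 < w" "w \<le> 1 / s" using s y by (auto simp: w_def intro!: divide_left_mono)
  have s1: "1 \<le> 1 / s" using s by simp
  have w2: "1 + w \<le> 2 / s" using add_mono[OF s1 w(2)] by simp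
  define p where "p = s * w"
  have p: "0 \<le> p" "p \<le> 1" using w s by (auto simp: p_def field_simps)
  define P where "P = (1 + w) * (1 + s\<^sup>2 * w)"
  have s2: "s\<^sup>2 * w \<le> w" using s w by (simp add: power_le_one mult_left_le_one_le)
  have s2p: "s\<^sup>2 * w \<le> s" 
  proof -
    have "s\<^sup>2 * w = s * p" by (simp add: p_def power2_eq_square)
    also have "\<dots> \<le> s * 1" using p s by (intro mult_left_mono) auto
    finally show ?thesis by simp
  qed
  have P0: "0 \<le> P" using w s by (simp add: P_def)
  have P1: "P \<le> (1 + w)\<^sup>2"
  proof -
    have "(1 + w) * (1 + s\<^sup>2 * w) \<le> (1 + w) * (1 + w)" using s2 w by (intro mult_left_mono) auto
    then show ?thesis by (simp only: P_def power2_eq_square[of "1 + w"])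
  qed
  have P2: "P \<le> 4 / s"
  proof -
    have "P \<le> (2 / s) * 2" unfolding P_def
      using w w2 s s2p by (intro mult_mono) auto
    then show ?thesis by simp
  qed
  \<comment> \<open>The cruder bound $P \le (1+w)^2$ is a perfect square, which gives the mixed term the shape $y + 1/y$.\<close>
  have root: "sqrt ((y\<^sup>2 + \<eta>\<^sup>2) * P) \<le> (y + \<eta>) * (1 + w)"
  proof (rule real_le_lsqrt)
    have "(y\<^sup>2 + \<eta>\<^sup>2) * P \<le> (y + \<eta>)\<^sup>2 * (1 + w)\<^sup>2"
      using P0 P1 y \<eta> by (intro mult_mono) (auto simp: power2_sum)
    then show "(y\<^sup>2 + \<eta>\<^sup>2) * P \<le> ((y + \<eta>) * (1 + w))\<^sup>2" by (simp add: power_mult_distrib)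
  qed (use y \<eta> w in auto)
  have yP: "y\<^sup>2 * P = (y + 1 / y) * (y + s\<^sup>2 / y)"
    using y by (simp add: P_def w_def power2_eq_square field_simps)
  have yw: "y * (1 + w) = y + 1 / y" using y by (simp add: w_def power2_eq_square field_simps)
  have cross: "2 * sqrt ((y\<^sup>2 + \<eta>\<^sup>2) * P) * (\<eta> * p) \<le> 2 * (y + 1 / y) * \<eta> + 4 / s * \<eta>\<^sup>2"
  proof -
    have "2 * sqrt ((y\<^sup>2 + \<eta>\<^sup>2) * P) * (\<eta> * p) \<le> 2 * ((y + \<eta>) * (1 + w)) * (\<eta> * 1)"
      using root p \<eta> y w P0 by (intro mult_mono) auto
    also have "\<dots> = 2 * (y * (1 + w)) * \<eta> + 2 * (1 + w) * \<eta>\<^sup>2"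
      by (simp add: algebra_simps power2_eq_square)
    also have "\<dots> \<le> 2 * (y * (1 + w)) * \<eta> + 4 / s * \<eta>\<^sup>2"
    proof -
      have "2 * (1 + w) \<le> 4 / s" using w2 by simp
      then have "2 * (1 + w) * \<eta>\<^sup>2 \<le> 4 / s * \<eta>\<^sup>2" by (rule mult_right_mono) simp
      then show ?thesis by simp
    qed
    finally show ?thesis unfolding yw .
  qed
  have last: "P * \<eta>\<^sup>2 + (\<eta> * p)\<^sup>2 \<le> 5 / s * \<eta>\<^sup>2"
  proof -
    have "p\<^sup>2 \<le> 1 / s" using p s1 power_le_one[of p 2] by simp
    then have "(P + p\<^sup>2) * \<eta>\<^sup>2 \<le> (4 / s + 1 / s) * \<eta>\<^sup>2" using P2 by (intro mult_right_mono add_mono) auto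
    then show ?thesis by (simp add: power_mult_distrib algebra_simps add_divide_distrib[symmetric])
  qed
  have "(sqrt ((y\<^sup>2 + \<eta>\<^sup>2) * P) + \<eta> * p)\<^sup>2
      = y\<^sup>2 * P + 2 * sqrt ((y\<^sup>2 + \<eta>\<^sup>2) * P) * (\<eta> * p) + (P * \<eta>\<^sup>2 + (\<eta> * p)\<^sup>2)"
    using P0 by (simp add: power2_sum algebra_simps)
  also have "\<dots> \<le> (y + 1 / y) * (y + s\<^sup>2 / y) + (2 * (y + 1 / y) * \<eta> + 4 / s * \<eta>\<^sup>2) + 5 / s * \<eta>\<^sup>2"
    unfolding yP by (intro add_mono order_refl cross last)
  also have "\<dots> = (y + 1 / y) * (y + s\<^sup>2 / y) + 2 * (y + 1 / y) * \<eta> + 9 / s * \<eta>\<^sup>2"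
    by (simp add: add_divide_distrib[symmetric] distrib_right[symmetric])
  finally show ?thesis by (simp add: P_def p_def w_def)
qed

text \<open>Below the threshold $\gamma^{1/4}$ the value of $f$ is the one of
  $(y + 1/y)(y + \gamma/y)$ at $y = \gamma^{1/4}$, but $g$ drops to $4$, which is smaller than
  $2 (y + 1/y)$ there unless $\gamma = 1$.  The factor $\gamma^{-5/4} \ge \gamma^{-1/4}$ makes up for this.\<close>

lemma truncated_bound_le:
  fixes \<gamma> x \<eta> :: real
  assumes \<gamma>: "0 < \<gamma>" "\<gamma> \<le> 1" and \<eta>: "0 \<le> \<eta>"
  defines "y \<equiv> max x (\<gamma> powr (1/4))"
  shows "(y + 1 / y) * (y + \<gamma> / y) + 2 * (y + 1 / y) * \<eta> + 9 / \<gamma> powr (1/2) * \<eta>\<^sup>2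
    \<le> f_bound \<gamma> x + 12 * \<gamma> powr (-5/4) * g_bound \<gamma> x * \<eta> + 36 * \<gamma> powr (-2) * \<eta>\<^sup>2"
proof -
  define q where "q = \<gamma> powr (1/4)"
  have q: "0 < q" "q \<le> 1" using \<gamma> by (auto simp: q_def powr_le1)
  have "\<gamma> powr 0 \<le> \<gamma> powr (-5/4)" "\<gamma> powr (- (1/4)) \<le> \<gamma> powr (-5/4)"
    using \<gamma> by (intro powr_mono'; simp)+
  then have g54: "1 \<le> \<gamma> powr (-5/4)" "1 / q \<le> \<gamma> powr (-5/4)"
    using \<gamma> unfolding q_def powr_minus_divide[of \<gamma> "1/4"] by simp_all
  have "\<gamma> powr (- (1/2)) \<le> \<gamma> powr (-2)"
    using \<gamma> by (intro powr_mono') simp_all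
  then have "1 / \<gamma> powr (1/2) \<le> \<gamma> powr (-2)"
    unfolding powr_minus_divide[of \<gamma> "1/2"] .
  then have "9 * (1 / \<gamma> powr (1/2)) \<le> 36 * \<gamma> powr (-2)" using powr_ge_zero[of \<gamma> "-2"] by linarith
  then have last: "9 / \<gamma> powr (1/2) * \<eta>\<^sup>2 \<le> 36 * \<gamma> powr (-2) * \<eta>\<^sup>2" by (intro mult_right_mono) auto
  show ?thesis
  proof (cases "q \<le> x")
    case True
    then have y: "y = x" by (simp add: y_def q_def)
    have "2 * (x + 1 / x) * 1 \<le> 2 * (x + 1 / x) * (12 * \<gamma> powr (-5/4))"
      using q True g54 by (intro mult_left_mono) auto
    then have "2 * (x + 1 / x) * \<eta> \<le> 12 * \<gamma> powr (-5/4) * g_bound \<gamma> x * \<eta>"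
      using True \<eta> by (intro mult_right_mono) (simp_all add: g_bound_def q_def mult_ac)
    then show ?thesis using last True unfolding y by (simp add: f_bound_def q_def)
  next
    case False
    then have y: "y = q" by (simp add: y_def q_def)
    have q2: "\<gamma> powr (1/2) = q\<^sup>2" and q4: "\<gamma> = q ^ 4"
      using \<gamma> by (simp_all add: q_def powr_powr flip: powr_numeral powr_realpow)
    have "(q + 1 / q) * (q + \<gamma> / q) = (\<gamma> powr (1/2) + 1)\<^sup>2"
      unfolding q2 using q by (subst q4) (simp add: field_simps power2_eq_square power4_eq_xxxx)
    moreover have "2 * (q + 1 / q) * \<eta> \<le> 12 * \<gamma> powr (-5/4) * g_bound \<gamma> x * \<eta>"
      using False q g54 \<eta> by (intro mult_right_mono) (simp_all add: g_bound_def q_def)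
    ultimately show ?thesis using last False unfolding y by (simp add: f_bound_def q_def)
  qed
qed

theorem lemma3p4:
  fixes X H B :: "complex mat" and n m :: nat and \<gamma> :: real
  assumes "X \<in> carrier_mat n m"
    and "X \<noteq> 0\<^sub>m n m"
    and "H = hermitization X"
    and "B = nonbacktracking H"
    and "0 < \<gamma>" and "\<gamma> \<le> 1"
    and "min (norm_2_inf X) (norm_2_inf (mat_adjoint X)) \<le> \<gamma> powr (1/2) * norm_2_inf H"
  shows "(sigma_max X)\<^sup>2 \<le>
      (norm_2_inf H)\<^sup>2 * f_bound \<gamma> (spectral_radius B / norm_2_inf H)
      + 12 * \<gamma> powr (-5/4) * g_bound \<gamma> (spectral_radius B / norm_2_inf H)
          * norm_2_inf H * norm_1_inf H
      + 36 * \<gamma> powr (-2) * (norm_1_inf H)\<^sup>2"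
proof -
  note X = assms(1)
  note H = hermitization_carrier_index[OF X, folded assms(3)] and Xa = mat_adjoint_carrier_index[OF X]
  define h where "h = norm_1_inf H"
  define N where "N = norm_2_inf H"
  define r where "r = norm_2_inf X"
  define c where "c = norm_2_inf (mat_adjoint X)"
  define s where "s = \<gamma> powr (1/2)"
  define \<rho> where "\<rho> = spectral_radius B"
  have s: "0 < s" "s \<le> 1" "s\<^sup>2 = \<gamma>"
    using assms by (auto simp: s_def powr_le1 powr_powr simp flip: powr_numeral)
  obtain i0 j0 where ij0: "i0 < n" "j0 < m" "X $$ (i0, j0) \<noteq> 0"
    using X assms(2) by (metis carrier_matD eq_matI index_zero_mat)
  then have nm: "0 < n" "0 < m" by auto
  have "0 < cmod (H $$ (i0, n + j0))" using H(2) ij0 by simp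
  also have "\<dots> \<le> h" unfolding h_def using ij0 by (intro norm_1_inf_ge[OF H(1)]) auto
  finally have h0: "0 < h" .
  have N_row: "(\<Sum>l<n + m. (cmod (H $$ (i, l)))\<^sup>2) \<le> N\<^sup>2" if "i < n + m" for i
    unfolding N_def by (rule row_sum_le_norm_2_inf_sq[OF H(1) that])
  have N0: "0 \<le> N" unfolding N_def using norm_2_inf_nonneg[OF H(1)] nm by simp
  have N: "0 < N"
  proof -
    have "0 < (cmod (H $$ (i0, n + j0)))\<^sup>2" using H(2) ij0 by simp
    also have "\<dots> \<le> (\<Sum>l<n + m. (cmod (H $$ (i0, l)))\<^sup>2)" using ij0 by (intro member_le_sum) auto
    also have "\<dots> \<le> N\<^sup>2" using N_row ij0 by simp
    finally show ?thesis using N0 by (cases "N = 0") auto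
  qed
  have rN: "0 \<le> r" "r \<le> N"
  proof -
    show "0 \<le> r" unfolding r_def using norm_2_inf_nonneg[OF X] nm by simp
    have "(\<Sum>j<m. (cmod (X $$ (i, j)))\<^sup>2) \<le> N\<^sup>2" if "i < n" for i
      using N_row[of i] that by (simp add: sum_lessThan_add H)
    then show "r \<le> N" unfolding r_def by (intro norm_2_inf_le[OF X nm(1) _ N0])
  qed
  have cN: "0 \<le> c" "c \<le> N"
  proof -
    show "0 \<le> c" unfolding c_def using norm_2_inf_nonneg[OF Xa(1)] nm by simp
    have "(\<Sum>j<n. (cmod (mat_adjoint X $$ (i, j)))\<^sup>2) \<le> N\<^sup>2" if "i < m" for i
      using N_row[of "n + i"] that by (simp add: sum_lessThan_add H Xa)
    then show "c \<le> N" unfolding c_def by (intro norm_2_inf_le[OF Xa(1) nm(2) _ N0])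
  qed
  have small: "r \<le> s * N \<or> c \<le> s * N"
    using assms(7) by (auto simp: s_def N_def r_def c_def min_le_iff_disj)
  \<comment> \<open>Truncating at $\gamma^{1/4}$ keeps $t^2 - h^2$ away from $0$.
    The threshold is the minimizer of $(y + 1/y)(y + \gamma/y)$.\<close>
  define y where "y = max (\<rho> / N) (\<gamma> powr (1/4))"
  define \<eta> where "\<eta> = h / N"
  \<comment> \<open>This choice makes $t^2 - h^2 = (N y)^2$, while $t$ still exceeds both $h$ and the spectral radius.\<close>
  define t where "t = N * sqrt (y\<^sup>2 + \<eta>\<^sup>2)"
  have \<eta>: "0 < \<eta>" using h0 N by (simp add: \<eta>_def)
  have y0: "0 < y" using assms by (simp add: y_def less_max_iff_disj)
  have "s = (\<gamma> powr (1/4))\<^sup>2" using assms by (simp add: s_def powr_powr flip: powr_numeral)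
  also have "\<dots> \<le> y\<^sup>2" by (intro power_mono) (auto simp: y_def)
  finally have sy: "s \<le> y\<^sup>2" .
  have t2: "t\<^sup>2 - h\<^sup>2 = (N * y)\<^sup>2"
    using N by (simp add: t_def \<eta>_def power_mult_distrib distrib_left power_divide)
  have "\<rho> / N \<le> y" by (simp add: y_def)
  then have "\<rho> \<le> N * y" using N by (simp add: pos_divide_le_eq mult.commute)
  also have "N * y < t" unfolding t_def
    using N y0 \<eta> by (intro mult_strict_left_mono real_less_rsqrt) auto
  finally have \<rho>t: "\<rho> < t" .
  have "\<eta> < sqrt (y\<^sup>2 + \<eta>\<^sup>2)" using y0 by (intro real_less_rsqrt) auto
  then have ht: "h < t" using N unfolding t_def by (simp add: \<eta>_def pos_divide_less_eq mult.commute)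
  have aspect: "(1 + r\<^sup>2 / (t\<^sup>2 - h\<^sup>2)) * (1 + c\<^sup>2 / (t\<^sup>2 - h\<^sup>2)) \<le> (1 + 1 / y\<^sup>2) * (1 + s\<^sup>2 / y\<^sup>2)"
    "r * c \<le> s * N\<^sup>2"
  proof -
    have full: "1 + a\<^sup>2 / (t\<^sup>2 - h\<^sup>2) \<le> 1 + b\<^sup>2 / y\<^sup>2" if "0 \<le> a" "a \<le> b * N" for a b
    proof -
      have "a\<^sup>2 / (N * y)\<^sup>2 \<le> (b * N)\<^sup>2 / (N * y)\<^sup>2" using that by (intro divide_right_mono power_mono) auto
      also have "\<dots> = b\<^sup>2 / y\<^sup>2" using N by (simp add: power_mult_distrib)
      finally show ?thesis unfolding t2 by simp
    qed
    have r1: "1 + r\<^sup>2 / (t\<^sup>2 - h\<^sup>2) \<le> 1 + 1 / y\<^sup>2" and c1: "1 + c\<^sup>2 / (t\<^sup>2 - h\<^sup>2) \<le> 1 + 1 / y\<^sup>2"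
      using full[of r 1] full[of c 1] rN cN by simp_all
    have nn: "0 \<le> 1 + a\<^sup>2 / (t\<^sup>2 - h\<^sup>2)" "0 \<le> 1 + 1 / y\<^sup>2" "0 \<le> 1 + s\<^sup>2 / y\<^sup>2" for a
      unfolding t2 by simp_all
    from small have "(1 + r\<^sup>2 / (t\<^sup>2 - h\<^sup>2)) * (1 + c\<^sup>2 / (t\<^sup>2 - h\<^sup>2)) \<le> (1 + 1 / y\<^sup>2) * (1 + s\<^sup>2 / y\<^sup>2) \<and> r * c \<le> s * N\<^sup>2"
    proof
      assume small_r: "r \<le> s * N"
      have "(1 + r\<^sup>2 / (t\<^sup>2 - h\<^sup>2)) * (1 + c\<^sup>2 / (t\<^sup>2 - h\<^sup>2)) \<le> (1 + s\<^sup>2 / y\<^sup>2) * (1 + 1 / y\<^sup>2)"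
        by (intro mult_mono full[OF rN(1) small_r] c1 nn)
      moreover have "r * c \<le> (s * N) * N"
        using small_r rN cN s N by (intro mult_mono) auto
      ultimately show ?thesis by (simp add: mult.commute mult.left_commute power2_eq_square)
    next
      assume small_c: "c \<le> s * N"
      have "(1 + r\<^sup>2 / (t\<^sup>2 - h\<^sup>2)) * (1 + c\<^sup>2 / (t\<^sup>2 - h\<^sup>2)) \<le> (1 + 1 / y\<^sup>2) * (1 + s\<^sup>2 / y\<^sup>2)"
        by (intro mult_mono full[OF cN(1) small_c] r1 nn)
      moreover have "r * c \<le> N * (s * N)"
        using small_c rN cN s N by (intro mult_mono) auto
      ultimately show ?thesis by (simp add: mult.left_commute power2_eq_square)
    qed
    then show "(1 + r\<^sup>2 / (t\<^sup>2 - h\<^sup>2)) * (1 + c\<^sup>2 / (t\<^sup>2 - h\<^sup>2)) \<le> (1 + 1 / y\<^sup>2) * (1 + s\<^sup>2 / y\<^sup>2)"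
      "r * c \<le> s * N\<^sup>2" by simp_all
  qed
  have "sigma_max X \<le> t * sqrt ((1 + r\<^sup>2 / (t\<^sup>2 - h\<^sup>2)) * (1 + c\<^sup>2 / (t\<^sup>2 - h\<^sup>2))) + h * r * c / (t\<^sup>2 - h\<^sup>2)"
    using singular_value_bound[OF X assms(2), of t] ht \<rho>t
    by (simp add: h_def r_def c_def \<rho>_def assms(3,4))
  also have "\<dots> \<le> t * sqrt ((1 + 1 / y\<^sup>2) * (1 + s\<^sup>2 / y\<^sup>2)) + h * (s * N\<^sup>2) / (t\<^sup>2 - h\<^sup>2)"
    unfolding mult.assoc[of h r c]
    using aspect h0 ht t2 by (intro add_mono mult_left_mono divide_right_mono real_sqrt_le_mono) auto
  also have "\<dots> = N * (sqrt ((y\<^sup>2 + \<eta>\<^sup>2) * ((1 + 1 / y\<^sup>2) * (1 + s\<^sup>2 / y\<^sup>2))) + \<eta> * (s / y\<^sup>2))"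
  proof -
    have "h * (s * N\<^sup>2) / (t\<^sup>2 - h\<^sup>2) = N * (\<eta> * (s / y\<^sup>2))"
      unfolding t2 using N by (simp add: \<eta>_def power_mult_distrib power2_eq_square)
    moreover have "t * sqrt ((1 + 1 / y\<^sup>2) * (1 + s\<^sup>2 / y\<^sup>2))
        = N * sqrt ((y\<^sup>2 + \<eta>\<^sup>2) * ((1 + 1 / y\<^sup>2) * (1 + s\<^sup>2 / y\<^sup>2)))"
      by (simp only: t_def real_sqrt_mult mult.assoc)
    ultimately show ?thesis by (simp only: distrib_left[of N])
  qed
  finally have "(sigma_max X)\<^sup>2 \<le> (N * (sqrt ((y\<^sup>2 + \<eta>\<^sup>2) * ((1 + 1 / y\<^sup>2) * (1 + s\<^sup>2 / y\<^sup>2))) + \<eta> * (s / y\<^sup>2)))\<^sup>2"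
    using sigma_max_attained[OF X nm(2)] by (intro power_mono) blast+
  also have "\<dots> \<le> N\<^sup>2 * ((y + 1 / y) * (y + s\<^sup>2 / y) + 2 * (y + 1 / y) * \<eta> + 9 / s * \<eta>\<^sup>2)"
    unfolding power_mult_distrib[of N]
    using s y0 sy \<eta> by (intro mult_left_mono deviation_scalar_bound) auto
  also have "\<dots> \<le> N\<^sup>2 * (f_bound \<gamma> (\<rho> / N) + 12 * \<gamma> powr (-5/4) * g_bound \<gamma> (\<rho> / N) * \<eta> + 36 * \<gamma> powr (-2) * \<eta>\<^sup>2)"
    unfolding s(3) unfolding s_def y_def
    using assms \<eta> by (intro mult_left_mono truncated_bound_le) auto
  also have "\<dots> = N\<^sup>2 * f_bound \<gamma> (\<rho> / N) + 12 * \<gamma> powr (-5/4) * g_bound \<gamma> (\<rho> / N) * N * h + 36 * \<gamma> powr (-2) * h\<^sup>2"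
  proof -
    have "N * \<eta> = h" using N by (simp add: \<eta>_def)
    then have e: "N\<^sup>2 * \<eta> = N * h" "N\<^sup>2 * \<eta>\<^sup>2 = h\<^sup>2" by (auto simp: power2_eq_square)
    have "N\<^sup>2 * (F + C * \<eta> + D * \<eta>\<^sup>2) = N\<^sup>2 * F + C * N * h + D * h\<^sup>2" for F C D
      unfolding mult.assoc e[symmetric] by (simp add: distrib_left mult.left_commute)
    then show ?thesis by (simp only:)
  qed
  finally show ?thesis unfolding N_def h_def \<rho>_def .
qed

end
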